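(* Let $d\ge 1$ be an integer, let $\alpha>d$ and $\lambda>0$, and let $(W_x)_{x\in\mathbb{Z}^d}$ be i.i.d. non-negative random variables, distributed as $W$. Assume that there exist $\tau>1$ and $c>0$ such that $$\mathbb{P}(W>w)\ge c\,w^{-(\tau-1)}\quad\text{for all } w\ge 1,$$ and such that $\gamma:=\alpha(\tau-1)/d\in(1,2)$. Then, for the random graph with edge probabilities $p_{xy}=1-\exp\{-\lambda W_xW_y/|x-y|^{\alpha}\}$ and for every $\eta>0$, $$\lim_{|x|\to\infty}\mathbb{P}\Big(d(0,x)\le (1+\eta)\frac{2\log\log|x|}{|\log(\gamma-1)|}\,\Big|\,0\longleftrightarrow x\Big)=1.$$
   Context: The random graph has vertex set $\mathbb{Z}^d$; conditionally on the weights $(W_x)_{x\in\mathbb{Z}^d}$, the edges between distinct vertices $x,y$ are independently present (occupied) with probability $p_{xy}=1-\exp\{-\lambda W_xW_y/|x-y|^{\alpha}\}$, where $|\cdot|$ is the Euclidean norm. The event $0\longleftrightarrow x$ is that $0$ and $x$ are joined by a path of occupied edges. The graph distance $d(0,x)$ is the minimum number of occupied edges forming a path from $0$ to $x$, with $d(0,x)=\infty$ if $0$ and $x$ are not connected (the integer $d$ without arguments is the dimension). The limit is over $x\in\mathbb{Z}^d$ with $|x|\to\infty$. Standing normalization: if the weights have finite mean, they are normalized so that $\mathbb{E}[W]=1$ (this amounts only to rescaling $\lambda$). *)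

theory Defs
  imports "HOL-Probability.Probability"
begin

text \<open>The lattice is the type \<^typ>\<open>int ^ 'd\<close>, of dimension \<open>CARD('d) \<ge> 1\<close>. It carries no norm in the
  library, so the Euclidean norm is taken after the coordinatewise embedding into \<open>real ^ 'd\<close>.\<close>

definition lattice_norm :: "int ^ 'd \<Rightarrow> real" where
  "lattice_norm x = norm (\<chi> i. real_of_int (x $ i))"

definition lattice_edges :: "(int ^ 'd) set set" where
  "lattice_edges = {{x, y} | x y. x \<noteq> y}"

definition occupied_path :: "'v set set \<Rightarrow> 'v \<Rightarrow> 'v \<Rightarrow> 'v list \<Rightarrow> bool" where
  "occupied_path G x y p \<longleftrightarrow>
     p \<noteq> [] \<and> hd p = x \<and> last p = y \<and> distinct p \<and> successively (\<lambda>u v. {u, v} \<in> G) p"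

definition joined :: "'v set set \<Rightarrow> 'v \<Rightarrow> 'v \<Rightarrow> bool" where
  "joined G x y \<longleftrightarrow> (\<exists>p. occupied_path G x y p)"

text \<open>A path with vertex list \<open>p\<close> has \<open>length p - 1\<close> edges. In \<^typ>\<open>enat\<close> the infimum of the empty
  set is \<open>\<infinity>\<close>.\<close>

definition graph_dist :: "'v set set \<Rightarrow> 'v \<Rightarrow> 'v \<Rightarrow> enat" where
  "graph_dist G x y = (INF p \<in> {p. occupied_path G x y p}. enat (length p - 1))"

text \<open>The sigma-algebra on the sample space generated by the whole family of weights.\<close>

definition weight_algebra :: "'a measure \<Rightarrow> ('v \<Rightarrow> 'a \<Rightarrow> real) \<Rightarrow> 'a measure" where
  "weight_algebra M W =
     vimage_algebra (space M) (\<lambda>\<omega> v. W v \<omega>) (PiM UNIV (\<lambda>_. borel))"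

text \<open>\<open>E \<omega>\<close> is the set of occupied edges and \<open>\<mu>\<close> the common law of the weights. Given the weights, the
  probability of an event is the conditional expectation of its indicator, and conditional
  independence of the edges is the product rule over finite edge sets, as in \<open>indep_events\<close>.\<close>

locale scale_free_percolation = prob_space M
  for M :: "'a measure" +
  fixes W :: "int ^ 'd \<Rightarrow> 'a \<Rightarrow> real"
    and E :: "'a \<Rightarrow> (int ^ 'd) set set"
    and \<mu> :: "real measure"
    and lam \<alpha> :: real
  assumes weights_indep: "indep_vars (\<lambda>_. borel) W UNIV"
    and weights_law: "\<And>x. distr M borel (W x) = \<mu>"
    and weights_nonneg: "AE w in \<mu>. 0 \<le> w"
    and edges_subset: "\<And>\<omega>. \<omega> \<in> space M \<Longrightarrow> E \<omega> \<subseteq> lattice_edges"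
    and edges_event: "\<And>e. e \<in> lattice_edges \<Longrightarrow> {\<omega> \<in> space M. e \<in> E \<omega>} \<in> sets M"
    and edges_prob: "\<And>x y. x \<noteq> y \<Longrightarrow>
      AE \<omega> in M. real_cond_exp M (weight_algebra M W) (indicator {\<omega> \<in> space M. {x, y} \<in> E \<omega>}) \<omega>
        = 1 - exp (- (lam * W x \<omega> * W y \<omega> / lattice_norm (x - y) powr \<alpha>))"
    and edges_cond_indep: "\<And>F. finite F \<Longrightarrow> F \<subseteq> lattice_edges \<Longrightarrow>
      AE \<omega> in M. real_cond_exp M (weight_algebra M W) (indicator {\<omega> \<in> space M. F \<subseteq> E \<omega>}) \<omega>
        = (\<Prod>e\<in>F. real_cond_exp M (weight_algebra M W) (indicator {\<omega> \<in> space M. e \<in> E \<omega>}) \<omega>)"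

end

theory Submission
  imports Defs
begin

text \<open>
  Put \<open>p = \<tau> - 1\<close>. A cube of large side \<open>r\<close> contains vertices of weight at least almost \<open>r powr (d / p)\<close>. Such a hub is adjacent, with
  overwhelming probability, to a hub of the larger scale \<open>r powr \<beta>\<close> as long as \<open>\<beta> < 1 / (\<gamma> - 1)\<close>. Along the
  scales \<open>radius k = 2 powr (\<beta> ^ k)\<close> the failure probabilities are summable, so that around every centre the hubs form a
  chain from some level on. The chain reaches the scale \<open>|x|\<close> after \<open>ln (ln |x|) / ln \<beta>\<close> levels. Since \<open>\<gamma> < 2\<close>, the hubs of
  scale \<open>|x|\<close> around 0 and around \<open>x\<close> are again adjacent with overwhelming probability. Two chains and one edge
  give a path with \<open>2 * ln (ln |x|) / ln \<beta>\<close> edges, and \<open>ln \<beta>\<close> may be taken as close to \<open>|ln (\<gamma> - 1)|\<close> as desired.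

  What remains is to reach the chain from 0, and likewise from \<open>x\<close>, in a bounded number of steps, given that 0 and
  \<open>x\<close> are joined. A finite cluster of 0 contains no distant \<open>x\<close>. So it is enough that an infinite cluster almost surely
  contains the hubs around its vertices from some level on (\<open>AE_infinite_joined_hubs\<close>): the distance to a fixed hub is then a finite
  random variable, and its law does not depend on the centre.

  This is a uniqueness statement for the infinite cluster. Let the core be the set of hubs whose chains never
  break, and suppose that an infinite cluster could miss it. By the finite energy property
  (\<open>emeasure_edge_insertion\<close>) a single edge from that cluster to the core could then be present with positive probability, so that
  an infinite piece of graph would hang off the core at a single edge. Let every vertex of such a
  hanging piece send mass 1 to the end point of the edge inside the piece. A vertex hangs in at most one way
  (\<open>port_unique\<close>), so it sends mass at most 1, but some vertices would receive infinite mass; this contradicts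
  translation invariance (\<open>mass_transport\<close>).

  Finally, conditioning is harmless because 0 and \<open>x\<close> are joined with probability bounded away from 0
  (\<open>prob_joined_bounded_below\<close>): both may have so large a weight that they are adjacent to their hubs.
\<close>

section \<open>Paths and graph distance\<close>

definition adjacency :: "'v set set \<Rightarrow> ('v \<times> 'v) set" where
  "adjacency G = {(u, v). {u, v} \<in> G}"

definition dist_le :: "'v set set \<Rightarrow> nat \<Rightarrow> 'v \<Rightarrow> 'v \<Rightarrow> bool" where
  "dist_le G n u v \<longleftrightarrow> (\<exists>p. occupied_path G u v p \<and> length p \<le> Suc n)"

definition cluster :: "'v set set \<Rightarrow> 'v \<Rightarrow> 'v set" where
  "cluster G u = {v. joined G u v}"

lemma sym_adjacency: "sym (adjacency G)"
  by (auto simp: sym_def adjacency_def insert_commute)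

lemma dist_le_refl: "dist_le G 0 u u"
  unfolding dist_le_def occupied_path_def by (intro exI[of _ "[u]"]) auto

text \<open>If \<open>w\<close> already lies on the path, cutting the path at \<open>w\<close> keeps it self-avoiding. This is why
  walks may be counted instead of self-avoiding paths from here on.\<close>

lemma dist_le_extend:
  assumes "dist_le G n u v" and "{v, w} \<in> G"
  shows "dist_le G (Suc n) u w"
proof -
  from assms(1) obtain p where p: "p \<noteq> []" "hd p = u" "last p = v" "distinct p"
      "successively (\<lambda>u v. {u, v} \<in> G) p" "length p \<le> Suc n"
    by (auto simp: dist_le_def occupied_path_def)
  show ?thesis
  proof (cases "w \<in> set p")
    case False
    have "occupied_path G u w (p @ [w])"
      using p False assms(2) by (auto simp: occupied_path_def successively_append_iff)
    then show ?thesis using p(6) by (auto simp: dist_le_def intro!: exI[of _ "p @ [w]"])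
  next
    case True
    then obtain ys zs where q: "p = ys @ w # zs" by (meson split_list)
    have "successively (\<lambda>u v. {u, v} \<in> G) (ys @ [w])"
      using p(5) unfolding q by (auto simp: successively_append_iff)
    moreover have "hd (ys @ [w]) = u" using p(2) q by (cases ys) auto
    ultimately have "occupied_path G u w (ys @ [w])"
      using p(4) by (auto simp: occupied_path_def q)
    moreover have "length (ys @ [w]) \<le> Suc n" using p(6) q by auto
    ultimately show ?thesis
      unfolding dist_le_def by (meson le_SucI)
  qed
qed

lemma relpow_imp_dist_le: "(u, v) \<in> adjacency G ^^ n \<Longrightarrow> dist_le G n u v"
proof (induction n arbitrary: v)
  case 0 then show ?case by (simp add: dist_le_refl)
next
  case (Suc n) then show ?case by (auto intro!: dist_le_extend simp: adjacency_def)
qed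

lemma successively_imp_relpow:
  "successively (\<lambda>u v. {u, v} \<in> G) p \<Longrightarrow> p \<noteq> [] \<Longrightarrow> (hd p, last p) \<in> adjacency G ^^ (length p - 1)"
proof (induction p rule: induct_list012)
  case (3 x y zs)
  then have "(x, y) \<in> adjacency G" "(y, last (y # zs)) \<in> adjacency G ^^ length zs"
    by (auto simp: adjacency_def)
  then have "(x, last (y # zs)) \<in> adjacency G ^^ Suc (length zs)" by (rule relpow_Suc_I2)
  then show ?case by simp
qed auto

lemma dist_le_iff: "dist_le G n u v \<longleftrightarrow> (\<exists>m\<le>n. (u, v) \<in> adjacency G ^^ m)"
proof
  assume "dist_le G n u v"
  then obtain p where p: "p \<noteq> []" "hd p = u" "last p = v"
      "successively (\<lambda>u v. {u, v} \<in> G) p" "length p \<le> Suc n"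
    by (auto simp: dist_le_def occupied_path_def)
  from successively_imp_relpow[OF p(4,1)] p show "\<exists>m\<le>n. (u, v) \<in> adjacency G ^^ m"
    by (intro exI[of _ "length p - 1"]) auto
next
  assume "\<exists>m\<le>n. (u, v) \<in> adjacency G ^^ m"
  then obtain m where m: "m \<le> n" "dist_le G m u v" by (auto dest: relpow_imp_dist_le)
  then show "dist_le G n u v" unfolding dist_le_def by (meson Suc_le_mono le_trans)
qed

lemma joined_iff_dist_le: "joined G u v \<longleftrightarrow> (\<exists>n. dist_le G n u v)"
  unfolding joined_def dist_le_def by (metis le_SucI order_refl)

lemma joined_iff: "joined G u v \<longleftrightarrow> (u, v) \<in> (adjacency G)\<^sup>*"
  by (auto simp: joined_iff_dist_le dist_le_iff rtrancl_power)

lemma joined_refl [simp]: "joined G u u" by (simp add: joined_iff)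

lemma joined_sym: "joined G u v \<Longrightarrow> joined G v u"
  by (simp add: joined_iff) (metis sym_adjacency sym_rtrancl symD)

lemma joined_trans: "joined G u v \<Longrightarrow> joined G v w \<Longrightarrow> joined G u w"
  by (simp add: joined_iff)

lemma joined_edge: "{u, v} \<in> G \<Longrightarrow> joined G u v"
  by (auto simp: joined_iff adjacency_def)

lemma dist_le_sym: "dist_le G n u v \<Longrightarrow> dist_le G n v u"
  unfolding dist_le_def occupied_path_def
  by (erule exE, rule_tac x = "rev p" in exI)
    (auto simp: hd_rev last_rev insert_commute)

lemma dist_le_trans:
  assumes "dist_le G m u v" and "dist_le G n v w"
  shows "dist_le G (m + n) u w"
proof -
  from assms obtain i j where "i \<le> m" "j \<le> n"
      "(u, v) \<in> adjacency G ^^ i" "(v, w) \<in> adjacency G ^^ j"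
    by (auto simp: dist_le_iff)
  then have "i + j \<le> m + n" "(u, w) \<in> adjacency G ^^ (i + j)"
    by (auto simp: relpow_add)
  then show ?thesis unfolding dist_le_iff by blast
qed

lemma dist_le_mono: "dist_le G m u v \<Longrightarrow> m \<le> n \<Longrightarrow> dist_le G n u v"
  unfolding dist_le_iff using le_trans by blast

lemma graph_dist_le_iff: "graph_dist G u v \<le> enat n \<longleftrightarrow> dist_le G n u v"
proof
  assume "dist_le G n u v"
  then obtain p where p: "occupied_path G u v p" "length p \<le> Suc n" by (auto simp: dist_le_def)
  have "graph_dist G u v \<le> enat (length p - 1)"
    unfolding graph_dist_def using p(1) by (intro INF_lower) auto
  also have "\<dots> \<le> enat n" using p(2) by auto
  finally show "graph_dist G u v \<le> enat n" .
next
  assume le: "graph_dist G u v \<le> enat n"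
  show "dist_le G n u v"
  proof (rule ccontr)
    assume no: "\<not> dist_le G n u v"
    have "enat (Suc n) \<le> graph_dist G u v"
      unfolding graph_dist_def
    proof (rule INF_greatest)
      fix p assume "p \<in> {p. occupied_path G u v p}"
      then have "\<not> length p \<le> Suc n" using no by (auto simp: dist_le_def)
      then show "enat (Suc n) \<le> enat (length p - 1)" by simp
    qed
    with le have "enat (Suc n) \<le> enat n" by (rule order_trans[rotated])
    then show False by simp
  qed
qed

lemma ereal_of_enat_le_iff:
  assumes "0 \<le> y" shows "ereal_of_enat d \<le> ereal y \<longleftrightarrow> d \<le> enat (nat \<lfloor>y\<rfloor>)"
proof (cases d)
  case (enat n)
  have "real n \<le> y \<longleftrightarrow> n \<le> nat \<lfloor>y\<rfloor>" using assms by linarith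
  then show ?thesis by (simp add: enat)
qed simp

text \<open>Hubs of different scales can be the same vertex; such a pair needs no edge.\<close>

definition adj_or_eq :: "'v set set \<Rightarrow> 'v \<Rightarrow> 'v \<Rightarrow> bool" where
  "adj_or_eq G u v \<longleftrightarrow> u = v \<or> {u, v} \<in> G"

lemma adj_or_eq_dist_le: "adj_or_eq G u v \<Longrightarrow> dist_le G 1 u v"
  using dist_le_extend[OF dist_le_refl, of u v G] dist_le_mono[OF dist_le_refl, of 1 G u]
  by (auto simp: adj_or_eq_def)

lemma adj_or_eq_joined: "adj_or_eq G u v \<Longrightarrow> joined G u v"
  by (auto dest: adj_or_eq_dist_le simp: joined_iff_dist_le)

lemma chain_dist_le:
  assumes "\<And>j. k \<le> j \<Longrightarrow> j < n \<Longrightarrow> adj_or_eq G (h j) (h (Suc j))" and "k \<le> n"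
  shows "dist_le G (n - k) (h k) (h n)"
  using assms(2,1)
proof (induction rule: dec_induct)
  case base then show ?case by (simp add: dist_le_refl)
next
  case (step n)
  then have "dist_le G (n - k) (h k) (h n)" "adj_or_eq G (h n) (h (Suc n))" by auto
  then have "dist_le G (n - k + 1) (h k) (h (Suc n))"
    by (intro dist_le_trans[OF _ adj_or_eq_dist_le])
  then show ?case using step by (simp add: Suc_diff_le)
qed

lemma cluster_joined_in:
  assumes "v \<in> cluster G u" shows "joined G v w \<longleftrightarrow> w \<in> cluster G u"
  using assms joined_sym[of G u v] joined_trans[of G u v w] joined_trans[of G v u w]
  by (auto simp: cluster_def)

section \<open>Pieces of a graph that hang off a set\<close>

text \<open>The edge from \<open>y\<close> to \<open>y + b\<close> is the only way out of a piece of graph hanging off the set \<open>K\<close>: once it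
  is deleted, the component of \<open>y\<close> misses \<open>K\<close>. The displacement \<open>b\<close> is fixed so that \<open>y\<close> determines the
  edge.\<close>

definition port :: "'v::group_add set set \<Rightarrow> 'v set \<Rightarrow> 'v set \<Rightarrow> 'v \<Rightarrow> 'v \<Rightarrow> bool" where
  "port G K L b y \<longleftrightarrow> y \<in> L \<and> {y, y + b} \<in> G \<and> y + b \<in> K \<and>
     cluster (G - {{y, y + b}}) y \<inter> K = {}"

text \<open>A vertex hangs below at most one port. If it hung below two, the path from it to the second port
  could leave the first piece only through a vertex of \<open>K\<close>, which the second piece does not contain.
  So the first piece contains the second port, hence also the second edge and its end in \<open>K\<close>, which
  is impossible. Ports lie in a set \<open>L\<close> disjoint from \<open>K\<close> so that the two edges differ.\<close>

lemma port_unique: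
  assumes KL: "K \<inter> L = {}" and y: "port G K L b y" and z: "port G K L b z"
    and x: "x \<in> cluster (G - {{y, y + b}}) y" "x \<in> cluster (G - {{z, z + b}}) z"
  shows "y = z"
proof (rule ccontr)
  assume "y \<noteq> z"
  define Cy where "Cy = cluster (G - {{y, y + b}}) y"
  define Cz where "Cz = cluster (G - {{z, z + b}}) z"
  have "(x, z) \<in> (adjacency (G - {{z, z + b}}))\<^sup>*"
    using x(2) joined_sym by (auto simp: cluster_def joined_iff)
  then have "z \<in> Cy"
  proof (induction rule: rtrancl_induct)
    case base then show ?case using x by (simp add: Cy_def)
  next
    case (step v w)
    have vw: "{v, w} \<in> G" "v \<in> Cy" using step by (auto simp: adjacency_def)
    have "w \<in> Cz"
    proof -
      have "joined (G - {{z, z + b}}) x w"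
        using step by (auto simp: joined_iff)
      then show ?thesis using cluster_joined_in[OF x(2)] by (simp add: Cz_def)
    qed
    have "{v, w} \<noteq> {y, y + b}"
    proof
      assume e: "{v, w} = {y, y + b}"
      have "y + b \<in> K" using y by (simp add: port_def)
      moreover have "v \<notin> K" using vw(2) y by (auto simp: port_def Cy_def)
      moreover have "w \<notin> K" using \<open>w \<in> Cz\<close> z by (auto simp: port_def Cz_def)
      ultimately show False using e by (auto simp: doubleton_eq_iff)
    qed
    then have "joined (G - {{y, y + b}}) v w" using vw by (intro joined_edge) auto
    then show ?case using cluster_joined_in[OF vw(2)[unfolded Cy_def]] by (simp add: Cy_def)
  qed
  have "{z, z + b} \<noteq> {y, y + b}"
  proof
    assume e: "{z, z + b} = {y, y + b}"
    then have "z = y + b" using \<open>y \<noteq> z\<close> by (auto simp: doubleton_eq_iff)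
    then have "z \<in> K \<inter> L" using y z by (auto simp: port_def)
    then show False using KL by auto
  qed
  then have "joined (G - {{y, y + b}}) z (z + b)"
    using z by (intro joined_edge) (auto simp: port_def)
  then have "z + b \<in> Cy" using cluster_joined_in[OF \<open>z \<in> Cy\<close>[unfolded Cy_def]] by (simp add: Cy_def)
  then show False using y z by (auto simp: port_def Cy_def)
qed

section \<open>The law of the weights and the edges\<close>

text \<open>The sets \<open>{G. F \<subseteq> G}\<close> with \<open>F\<close> finite generate the same sigma-algebra as the single edge events, and they are
  closed under intersection. Their probabilities are exactly what conditional independence of the
  edges prescribes, so a law of graphs is determined by them.\<close>

definition edge_space :: "'v set set measure" where
  "edge_space = sigma UNIV {{G. F \<subseteq> G} | F. finite F}"

abbreviation weight_space :: "('v \<Rightarrow> real) measure" where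
  "weight_space \<equiv> PiM UNIV (\<lambda>_. borel)"

definition config_space :: "(('v \<Rightarrow> real) \<times> 'v set set) measure" where
  "config_space = weight_space \<Otimes>\<^sub>M edge_space"

lemma space_edge_space [simp]: "space edge_space = UNIV"
  unfolding edge_space_def by (rule space_measure_of) auto

lemma sets_edge_space: "sets edge_space = sigma_sets UNIV {{G. F \<subseteq> G} | F. finite F}"
  unfolding edge_space_def by (rule sets_measure_of) auto

lemma space_weight_space [simp]: "space weight_space = UNIV"
  by (simp add: space_PiM)

lemma space_config_space [simp]: "space config_space = UNIV"
  by (simp add: config_space_def space_pair_measure space_PiM)

lemma up_set_in_edge_space: "finite F \<Longrightarrow> {G. F \<subseteq> G} \<in> sets edge_space"
  unfolding sets_edge_space by auto

lemma pred_edge_mem: "Measurable.pred edge_space (\<lambda>G. e \<in> G)"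
  using up_set_in_edge_space[of "{e}"] by (simp add: pred_def)

lemma measurable_edge_space:
  assumes "\<And>e. Measurable.pred M (\<lambda>x. e \<in> f x)"
  shows "f \<in> M \<rightarrow>\<^sub>M edge_space"
  unfolding edge_space_def
proof (rule measurable_measure_of)
  fix Y :: "'a set set set" assume "Y \<in> {{G. F \<subseteq> G} | F. finite F}"
  then obtain F :: "'a set set" where F: "finite F" "Y = {G. F \<subseteq> G}" by auto
  have "Measurable.pred M (\<lambda>x. \<forall>e\<in>F. e \<in> f x)"
    using F(1) assms by (intro pred_intros_finite) auto
  moreover have "f -` Y \<inter> space M = {x \<in> space M. \<forall>e\<in>F. e \<in> f x}"
    using F by auto
  ultimately show "f -` Y \<inter> space M \<in> sets M" by (simp add: pred_def)
qed auto

lemma measurable_fst_config [measurable]: "fst \<in> config_space \<rightarrow>\<^sub>M weight_space"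
  by (simp add: config_space_def)

lemma measurable_snd_config [measurable]: "snd \<in> config_space \<rightarrow>\<^sub>M edge_space"
  by (simp add: config_space_def)

lemma measurable_weight [measurable]: "(\<lambda>p. fst p v) \<in> borel_measurable config_space"
  using measurable_compose[OF measurable_fst_config measurable_component_singleton[of v UNIV]]
  by simp

lemma pred_edge [measurable]: "Measurable.pred config_space (\<lambda>p. e \<in> snd p)"
  by (rule measurable_compose[OF measurable_snd_config pred_edge_mem])

lemma measurable_config:
  assumes "\<And>v. f v \<in> borel_measurable M"
    and "\<And>e. Measurable.pred M (\<lambda>x. e \<in> g x)"
  shows "(\<lambda>x. (\<lambda>v. f v x, g x)) \<in> M \<rightarrow>\<^sub>M config_space"
  unfolding config_space_def
  by (intro measurable_Pair measurable_edge_space assms measurable_PiM_single')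
    (auto simp: assms)

definition cylinders :: "(('v \<Rightarrow> real) \<times> 'v set set) set set" where
  "cylinders = {A \<times> {G. F \<subseteq> G} | A F. A \<in> sets weight_space \<and> finite F}"

lemma Int_stable_cylinders: "Int_stable cylinders"
proof (rule Int_stableI)
  fix X Y :: "(('v \<Rightarrow> real) \<times> 'v set set) set"
  assume "X \<in> cylinders" "Y \<in> cylinders"
  then obtain A B F H where XY: "X = A \<times> {G. F \<subseteq> G}" "Y = B \<times> {G. H \<subseteq> G}"
      "A \<in> sets weight_space" "B \<in> sets weight_space" "finite F" "finite H"
    by (auto simp: cylinders_def)
  have "X \<inter> Y = (A \<inter> B) \<times> {G. F \<union> H \<subseteq> G}" using XY by auto
  moreover have "A \<inter> B \<in> sets weight_space" using XY by auto
  ultimately show "X \<inter> Y \<in> cylinders"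
    using XY unfolding cylinders_def by blast
qed

lemma sets_config_space: "sets config_space = sigma_sets UNIV (cylinders :: (('v \<Rightarrow> real) \<times> 'v set set) set set)"
proof
  let ?C = "cylinders :: (('v \<Rightarrow> real) \<times> 'v set set) set set"
  have "A \<times> B \<in> sets (sigma UNIV ?C)"
    if A: "A \<in> sets weight_space" and B: "B \<in> sets edge_space" for A and B :: "'v set set set"
  proof -
    have univ: "A \<times> UNIV \<in> sigma_sets UNIV ?C"
    proof (rule sigma_sets.Basic)
      have "A \<times> UNIV = A \<times> {G :: 'v set set. {} \<subseteq> G}" by auto
      then show "A \<times> UNIV \<in> ?C" using A unfolding cylinders_def by blast
    qed
    from B have "A \<times> B \<in> sigma_sets UNIV ?C"
      unfolding sets_edge_space
    proof induction
      case (Basic b)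
      then show ?case using A by (auto simp: cylinders_def)
    next
      case Empty
      then show ?case by (simp add: sigma_sets.Empty)
    next
      case (Compl b)
      have "A \<times> (UNIV - b) = A \<times> UNIV - A \<times> b" by auto
      moreover have "A \<times> UNIV - A \<times> b \<in> sets (sigma UNIV ?C)"
        using Compl univ by (intro sets.Diff) auto
      ultimately show ?case by simp
    next
      case (Union b)
      have "A \<times> \<Union> (range b) = (\<Union>i. A \<times> b i)" by auto
      then show ?case using Union by (auto intro: sigma_sets.Union)
    qed
    then show ?thesis by simp
  qed
  then have "sets config_space \<subseteq> sets (sigma UNIV ?C)"
    unfolding config_space_def by (rule sets_pair_in_sets)
  then show "sets config_space \<subseteq> sigma_sets UNIV ?C" by simp
  have "sigma_sets (space config_space) ?C \<subseteq> sets config_space"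
    by (rule sets.sigma_sets_subset)
      (auto simp: cylinders_def config_space_def up_set_in_edge_space)
  then show "sigma_sets UNIV ?C \<subseteq> sets config_space" by simp
qed

text \<open>Uniqueness of measures on an intersection-stable generator. It is the only tool by which laws of
  weights and edges are compared below.\<close>

lemma config_measure_eqI:
  fixes N N' :: "(('v \<Rightarrow> real) \<times> 'v set set) measure"
  assumes "sets N = sets config_space" "sets N' = sets config_space" "finite_measure N"
    and eq: "\<And>A F. A \<in> sets weight_space \<Longrightarrow> finite F \<Longrightarrow>
      emeasure N (A \<times> {G. F \<subseteq> G}) = emeasure N' (A \<times> {G. F \<subseteq> G})"
  shows "N = N'"
proof (rule measure_eqI_generator_eq[where E = cylinders and \<Omega> = UNIV and A = "\<lambda>_. UNIV"])
  show "emeasure N X = emeasure N' X" if "X \<in> cylinders" for X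
    using that eq by (auto simp: cylinders_def)
  show "range (\<lambda>_::nat. UNIV :: (('v \<Rightarrow> real) \<times> 'v set set) set) \<subseteq> cylinders"
  proof -
    have "UNIV = UNIV \<times> {G :: 'v set set. {} \<subseteq> G}" by auto
    moreover have "UNIV \<in> sets weight_space" using sets.top[of weight_space] by simp
    ultimately have "(UNIV :: (('v \<Rightarrow> real) \<times> 'v set set) set) \<in> cylinders"
      unfolding cylinders_def by blast
    then show ?thesis by auto
  qed
  show "emeasure N UNIV \<noteq> \<infinity>"
    using assms(3) finite_measure.emeasure_finite by auto
qed (auto simp: Int_stable_cylinders assms sets_config_space)

text \<open>The length and, below, the weight product are functions of the unordered edge, so that products over
  sets of edges make sense.\<close>

definition edge_length :: "(int ^ 'd) set \<Rightarrow> real" where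
  "edge_length e = (THE r. \<exists>x y. e = {x, y} \<and> x \<noteq> y \<and> r = lattice_norm (x - y))"

lemma lattice_norm_minus: "lattice_norm (- x) = lattice_norm x"
proof -
  have "(\<chi> i. real_of_int ((- x) $ i)) = - (\<chi> i. real_of_int (x $ i))" by (simp add: vec_eq_iff)
  then show ?thesis unfolding lattice_norm_def by simp
qed

lemma lattice_norm_commute: "lattice_norm (x - y) = lattice_norm (y - x)"
  using lattice_norm_minus[of "x - y"] by simp

lemma edge_length_eq: "x \<noteq> y \<Longrightarrow> edge_length {x, y} = lattice_norm (x - y)"
  unfolding edge_length_def
  by (rule the_equality) (auto simp: doubleton_eq_iff lattice_norm_commute)

lemma lattice_norm_eq_0_iff: "lattice_norm x = 0 \<longleftrightarrow> x = 0"
  by (auto simp: lattice_norm_def vec_eq_iff)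

lemma lattice_norm_pos: "x \<noteq> y \<Longrightarrow> 0 < lattice_norm (x - y)"
  using lattice_norm_eq_0_iff[of "x - y"] by (simp add: lattice_norm_def order_less_le)

definition translate :: "(int ^ 'd) \<Rightarrow> ((int ^ 'd) \<Rightarrow> real) \<times> (int ^ 'd) set set \<Rightarrow>
    ((int ^ 'd) \<Rightarrow> real) \<times> (int ^ 'd) set set" where
  "translate a p = (\<lambda>v. fst p (v + a), {e. (\<lambda>v. v + a) ` e \<in> snd p})"

lemma measurable_translate [measurable]: "translate a \<in> config_space \<rightarrow>\<^sub>M config_space"
  unfolding translate_def by (intro measurable_config) auto

context scale_free_percolation
begin

definition config :: "'a \<Rightarrow> ((int ^ 'd) \<Rightarrow> real) \<times> (int ^ 'd) set set" where
  "config \<omega> = (\<lambda>v. W v \<omega>, E \<omega>)"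

lemma fst_config [simp]: "fst (config \<omega>) = (\<lambda>v. W v \<omega>)" and snd_config [simp]: "snd (config \<omega>) = E \<omega>"
  by (simp_all add: config_def)

lemma measurable_W [measurable]: "W v \<in> borel_measurable M"
  using weights_indep by (auto simp: indep_vars_def)

lemma measurable_W_space [measurable]: "(\<lambda>\<omega> v. W v \<omega>) \<in> M \<rightarrow>\<^sub>M weight_space"
  by (rule measurable_PiM_single') auto

lemma not_lattice_edge: "\<omega> \<in> space M \<Longrightarrow> e \<notin> lattice_edges \<Longrightarrow> e \<notin> E \<omega>"
  using edges_subset by auto

lemma pred_E [measurable]: "Measurable.pred M (\<lambda>\<omega>. e \<in> E \<omega>)"
proof (cases "e \<in> lattice_edges")
  case True then show ?thesis using edges_event[of e] by (simp add: pred_def)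
next
  case False
  then have "{\<omega> \<in> space M. e \<in> E \<omega>} = {}" using not_lattice_edge by auto
  then show ?thesis unfolding pred_def by (simp only: sets.empty_sets)
qed

lemma measurable_config_M [measurable]: "config \<in> M \<rightarrow>\<^sub>M config_space"
  unfolding config_def by (intro measurable_config) auto

lemma prob_space_mu: "prob_space \<mu>"
  using weights_law[of 0, symmetric] by (auto intro!: prob_space_distr)

lemma sets_mu [measurable_cong, simp]: "sets \<mu> = sets borel"
  using weights_law[of 0, symmetric] by simp

lemma AE_weights_nonneg: "AE \<omega> in M. \<forall>v. 0 \<le> W v \<omega>"
proof -
  have "AE \<omega> in M. 0 \<le> W v \<omega>" for v
    using weights_nonneg unfolding weights_law[of v, symmetric]
    by (subst (asm) AE_distr_iff) auto
  then show ?thesis by (simp add: AE_all_countable)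
qed

lemma distr_weights: "distr M weight_space (\<lambda>\<omega> v. W v \<omega>) = PiM UNIV (\<lambda>_. \<mu>)"
  using indep_vars_iff_distr_eq_PiM[where I = UNIV and M' = "\<lambda>_. borel" and X = W] weights_indep
  by (simp add: weights_law restrict_UNIV)

definition edge_prob :: "((int ^ 'd) \<Rightarrow> real) \<Rightarrow> (int ^ 'd) set \<Rightarrow> real" where
  "edge_prob w e = 1 - exp (- (lam * (\<Prod>v\<in>e. w v) / edge_length e powr \<alpha>))"

lemma edge_prob_eq:
  "x \<noteq> y \<Longrightarrow> edge_prob w {x, y} = 1 - exp (- (lam * w x * w y / lattice_norm (x - y) powr \<alpha>))"
  by (simp add: edge_prob_def edge_length_eq mult.assoc)

lemma measurable_edge_prob [measurable]:
  "(\<lambda>w. edge_prob w e) \<in> borel_measurable weight_space"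
  unfolding edge_prob_def by measurable

lemma edge_prob_le_1: "edge_prob w e \<le> 1"
  by (simp add: edge_prob_def)

lemma subalgebra_weights: "subalgebra M (weight_algebra M W)"
  unfolding subalgebra_def weight_algebra_def
  using sets_image_in_sets[OF refl measurable_W_space] by auto

lemma measurable_weight_algebra:
  assumes "g \<in> borel_measurable weight_space"
  shows "(\<lambda>\<omega>. g (\<lambda>v. W v \<omega>)) \<in> borel_measurable (weight_algebra M W)"
  unfolding weight_algebra_def
  by (rule measurable_compose[OF measurable_vimage_algebra1 assms]) auto

lemma AE_cond_exp_edge:
  assumes "e \<in> lattice_edges"
  shows "AE \<omega> in M. real_cond_exp M (weight_algebra M W) (indicator {\<omega> \<in> space M. e \<in> E \<omega>}) \<omega>
    = edge_prob (\<lambda>v. W v \<omega>) e"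
proof -
  from assms obtain x y where "e = {x, y}" "x \<noteq> y" by (auto simp: lattice_edges_def)
  then show ?thesis using edges_prob[of x y] by (simp add: edge_prob_eq)
qed

text \<open>Integrates out the edges: given the weights, the edges of \<open>F\<close> are all present with the product of the
  connection probabilities.\<close>

lemma integral_edges:
  assumes F: "finite F" "F \<subseteq> lattice_edges"
    and [measurable]: "g \<in> borel_measurable weight_space" and bd: "\<And>w. \<bar>g w\<bar> \<le> B"
  shows "(\<integral>\<omega>. g (\<lambda>v. W v \<omega>) * indicator {\<omega> \<in> space M. F \<subseteq> E \<omega>} \<omega> \<partial>M) =
    (\<integral>\<omega>. g (\<lambda>v. W v \<omega>) * (\<Prod>e\<in>F. edge_prob (\<lambda>v. W v \<omega>) e) \<partial>M)"
proof -
  let ?A = "weight_algebra M W"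
  interpret A: sigma_finite_subalgebra M ?A
    using finite_measure_subalgebra_is_sigma_finite[of M ?A] subalgebra_weights
    by (simp add: finite_measure_subalgebra_def finite_measure_subalgebra_axioms_def finite_measure_axioms)
  have ev: "{\<omega> \<in> space M. F \<subseteq> E \<omega>} \<in> sets M"
  proof -
    have "Measurable.pred M (\<lambda>\<omega>. \<forall>e\<in>F. e \<in> E \<omega>)" using F(1) by (intro pred_intros_finite) auto
    then show ?thesis by (simp add: pred_def subset_eq)
  qed
  have "AE \<omega> in M. \<forall>e\<in>F. real_cond_exp M ?A (indicator {\<omega> \<in> space M. e \<in> E \<omega>}) \<omega>
    = edge_prob (\<lambda>v. W v \<omega>) e"
    using F AE_cond_exp_edge by (subst AE_ball_countable) (auto simp: countable_finite)
  with edges_cond_indep[OF F]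
  have "AE \<omega> in M. real_cond_exp M ?A (indicator {\<omega> \<in> space M. F \<subseteq> E \<omega>}) \<omega>
    = (\<Prod>e\<in>F. edge_prob (\<lambda>v. W v \<omega>) e)"
    by eventually_elim (auto intro!: prod.cong)
  then have "(\<integral>\<omega>. g (\<lambda>v. W v \<omega>) * (\<Prod>e\<in>F. edge_prob (\<lambda>v. W v \<omega>) e) \<partial>M)
    = (\<integral>\<omega>. g (\<lambda>v. W v \<omega>) * real_cond_exp M ?A (indicator {\<omega> \<in> space M. F \<subseteq> E \<omega>}) \<omega> \<partial>M)"
    by (intro integral_cong_AE) auto
  also have "\<dots> = (\<integral>\<omega>. g (\<lambda>v. W v \<omega>) * indicator {\<omega> \<in> space M. F \<subseteq> E \<omega>} \<omega> \<partial>M)"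
  proof (rule A.real_cond_exp_intg(2))
    show "integrable M (\<lambda>\<omega>. g (\<lambda>v. W v \<omega>) * indicator {\<omega> \<in> space M. F \<subseteq> E \<omega>} \<omega>)"
      using ev bd by (intro integrable_const_bound[of _ B]) (auto simp: indicator_def abs_mult split: if_splits intro: order_trans[OF abs_ge_zero])
  qed (use ev in \<open>auto intro: measurable_weight_algebra\<close>)
  finally show ?thesis ..
qed

definition law :: "(((int ^ 'd) \<Rightarrow> real) \<times> (int ^ 'd) set set) measure" where
  "law = distr M config_space config"

lemma prob_space_law: "prob_space law"
  unfolding law_def by (rule prob_space_distr) simp

lemma sets_law [simp, measurable_cong]: "sets law = sets config_space"
  by (simp add: law_def)

text \<open>The value depends only on \<open>\<mu>\<close>, \<open>lam\<close> and \<open>\<alpha>\<close>. So a translation of the configuration amounts to a change of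
  variables in an integral over the weights.\<close>

lemma emeasure_law_cylinder:
  assumes [measurable]: "A \<in> sets weight_space" and F: "finite F"
  shows "emeasure law (A \<times> {G. F \<subseteq> G}) = (if F \<subseteq> lattice_edges then
    ennreal (\<integral>w. indicator A w * (\<Prod>e\<in>F. edge_prob w e) \<partial>PiM UNIV (\<lambda>_. \<mu>)) else 0)"
proof -
  have "A \<times> {G. F \<subseteq> G} \<in> sets config_space"
    using F by (auto simp: config_space_def up_set_in_edge_space)
  then have "emeasure law (A \<times> {G. F \<subseteq> G}) = emeasure M (config -` (A \<times> {G. F \<subseteq> G}) \<inter> space M)"
    unfolding law_def by (intro emeasure_distr) auto
  also have "config -` (A \<times> {G. F \<subseteq> G}) \<inter> space M =
      {\<omega> \<in> space M. (\<lambda>v. W v \<omega>) \<in> A \<and> (\<forall>e\<in>F. e \<in> E \<omega>)}" (is "_ = ?S")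
    by (auto simp: config_def)
  finally have eq: "emeasure law (A \<times> {G. F \<subseteq> G}) = emeasure M ?S" .
  show ?thesis
  proof (cases "F \<subseteq> lattice_edges")
    case True
    have [measurable]: "Measurable.pred M (\<lambda>\<omega>. \<forall>e\<in>F. e \<in> E \<omega>)"
      using F(1) by (intro pred_intros_finite) auto
    have "emeasure M ?S = ennreal (\<integral>\<omega>. indicator ?S \<omega> \<partial>M)"
      by (simp add: emeasure_eq_measure)
    also have "(\<integral>\<omega>. indicator ?S \<omega> \<partial>M) =
        ((\<integral>\<omega>. indicator A (\<lambda>v. W v \<omega>) * indicator {\<omega> \<in> space M. F \<subseteq> E \<omega>} \<omega> \<partial>M) :: real)"
      by (intro Bochner_Integration.integral_cong) (auto simp: indicator_def)
    also have "\<dots> = (\<integral>\<omega>. indicator A (\<lambda>v. W v \<omega>) * (\<Prod>e\<in>F. edge_prob (\<lambda>v. W v \<omega>) e) \<partial>M)"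
      using F True by (intro integral_edges[where B = 1]) (auto simp: indicator_def)
    also have "\<dots> = (\<integral>w. indicator A w * (\<Prod>e\<in>F. edge_prob w e)
        \<partial>distr M weight_space (\<lambda>\<omega> v. W v \<omega>))"
      by (rule integral_distr[symmetric]) auto
    finally show ?thesis using True eq by (simp add: distr_weights)
  next
    case False
    then have "?S = {}" using not_lattice_edge by auto
    then show ?thesis using eq False by (simp only: emeasure_empty if_False)
  qed
qed

lemma edge_prob_translate:
  assumes "e \<in> lattice_edges"
  shows "edge_prob w ((\<lambda>v. v + a) ` e) = edge_prob (\<lambda>v. w (v + a)) e"
proof -
  from assms obtain x y where e: "e = {x, y}" "x \<noteq> y" by (auto simp: lattice_edges_def)
  then have "(\<lambda>v. v + a) ` e = {x + a, y + a}" "x + a \<noteq> y + a" by auto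
  then show ?thesis using e by (simp add: edge_prob_eq)
qed

lemma lattice_edge_translate: "(\<lambda>v. v + a) ` e \<in> lattice_edges \<longleftrightarrow> e \<in> lattice_edges"
proof
  assume "e \<in> lattice_edges"
  then show "(\<lambda>v. v + a) ` e \<in> lattice_edges" unfolding lattice_edges_def by fastforce
next
  assume "(\<lambda>v. v + a) ` e \<in> lattice_edges"
  then obtain x y where xy: "(\<lambda>v. v + a) ` e = {x, y}" "x \<noteq> y" by (auto simp: lattice_edges_def)
  have "e = (\<lambda>v. v - a) ` (\<lambda>v. v + a) ` e" by (simp add: image_image)
  also have "\<dots> = {x - a, y - a}" by (simp add: xy)
  finally have "e = {x - a, y - a}" .
  moreover have "x - a \<noteq> y - a" using xy(2) by simp
  ultimately show "e \<in> lattice_edges" unfolding lattice_edges_def by blast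
qed

text \<open>The product measure of the weights is invariant under relabelling, and the connection probability
  depends on the end points only through their weights and their difference.\<close>

lemma distr_law_translate: "distr law config_space (translate a) = law"
proof (rule config_measure_eqI[symmetric])
  show "finite_measure law" using prob_space_law by (simp add: prob_space.finite_measure)
next
  fix A :: "((int ^ 'd) \<Rightarrow> real) set" and F :: "(int ^ 'd) set set"
  assume A[measurable]: "A \<in> sets weight_space" and F: "finite F"
  define s :: "((int ^ 'd) \<Rightarrow> real) \<Rightarrow> (int ^ 'd) \<Rightarrow> real" where "s = (\<lambda>w v. w (v + a))"
  have s[measurable]: "s \<in> weight_space \<rightarrow>\<^sub>M weight_space"
    unfolding s_def by (rule measurable_PiM_single') auto
  define A' where "A' = s -` A"
  have A'[measurable]: "A' \<in> sets weight_space"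
    using measurable_sets[OF s A] by (simp add: A'_def)
  define F' where "F' = (\<lambda>e. (\<lambda>v. v + a) ` e) ` F"
  have inj: "inj (\<lambda>e :: (int ^ 'd) set. (\<lambda>v. v + a) ` e)"
    by (rule injI) (simp add: inj_image_eq_iff)
  interpret mu: prob_space \<mu> by (rule prob_space_mu)
  have PiM_s: "distr (PiM UNIV (\<lambda>_. \<mu>)) (PiM UNIV (\<lambda>_. \<mu>)) s = PiM UNIV (\<lambda>_. \<mu>)"
    using distr_PiM_reindex[of UNIV "\<lambda>_. \<mu>" "\<lambda>v. v + a" UNIV] mu.prob_space_axioms
    by (simp add: s_def restrict_UNIV)
  have sets_eq: "sets (PiM UNIV (\<lambda>_. \<mu>)) = sets weight_space"
    by (rule sets_PiM_cong) auto
  have "A \<times> {G. F \<subseteq> G} \<in> sets config_space"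
    using F by (auto simp: config_space_def up_set_in_edge_space)
  then have "emeasure (distr law config_space (translate a)) (A \<times> {G. F \<subseteq> G}) =
      emeasure law (translate a -` (A \<times> {G. F \<subseteq> G}) \<inter> space law)"
    by (intro emeasure_distr) (auto cong: measurable_cong_sets)
  also have "translate a -` (A \<times> {G. F \<subseteq> G}) \<inter> space law = A' \<times> {G. F' \<subseteq> G}"
  proof (rule set_eqI)
    fix p :: "((int ^ 'd) \<Rightarrow> real) \<times> (int ^ 'd) set set"
    have "{e. (\<lambda>v. v + a) ` e \<in> snd p} \<supseteq> F \<longleftrightarrow> F' \<subseteq> snd p"
      unfolding F'_def by blast
    then show "p \<in> translate a -` (A \<times> {G. F \<subseteq> G}) \<inter> space law \<longleftrightarrow> p \<in> A' \<times> {G. F' \<subseteq> G}"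
      by (cases p) (simp add: translate_def A'_def s_def law_def)
  qed
  also have "emeasure law (A' \<times> {G. F' \<subseteq> G}) = emeasure law (A \<times> {G. F \<subseteq> G})"
  proof -
    have F'e: "F' \<subseteq> lattice_edges \<longleftrightarrow> F \<subseteq> lattice_edges"
      by (auto simp: F'_def lattice_edge_translate image_subset_iff)
    have "(\<integral>w. indicator A' w * (\<Prod>e\<in>F'. edge_prob w e) \<partial>PiM UNIV (\<lambda>_. \<mu>)) =
        (\<integral>w. indicator A w * (\<Prod>e\<in>F. edge_prob w e) \<partial>PiM UNIV (\<lambda>_. \<mu>))"
      if Fe: "F \<subseteq> lattice_edges"
    proof -
      have "(\<Prod>e\<in>F'. edge_prob w e) = (\<Prod>e\<in>F. edge_prob (s w) e)" for w
        unfolding F'_def s_def using Fe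
        by (subst prod.reindex) (auto intro!: prod.cong edge_prob_translate inj_on_subset[OF inj])
      then have "(\<integral>w. indicator A' w * (\<Prod>e\<in>F'. edge_prob w e) \<partial>PiM UNIV (\<lambda>_. \<mu>)) =
          (\<integral>w. indicator A (s w) * (\<Prod>e\<in>F. edge_prob (s w) e) \<partial>PiM UNIV (\<lambda>_. \<mu>))"
        by (intro Bochner_Integration.integral_cong) (auto simp: A'_def indicator_def)
      also have "\<dots> = (\<integral>w. indicator A w * (\<Prod>e\<in>F. edge_prob w e)
          \<partial>distr (PiM UNIV (\<lambda>_. \<mu>)) (PiM UNIV (\<lambda>_. \<mu>)) s)"
        by (rule integral_distr[symmetric]) (auto simp: sets_eq cong: measurable_cong_sets)
      finally show ?thesis by (simp add: PiM_s)
    qed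
    moreover have "finite F'" using F by (simp add: F'_def)
    ultimately show ?thesis using F F'e by (simp add: emeasure_law_cylinder)
  qed
  finally show "emeasure law (A \<times> {G. F \<subseteq> G}) =
    emeasure (distr law config_space (translate a)) (A \<times> {G. F \<subseteq> G})" ..
qed auto

lemma prob_translate:
  assumes P: "Measurable.pred config_space P"
  shows "prob {\<omega> \<in> space M. P (translate a (config \<omega>))} = prob {\<omega> \<in> space M. P (config \<omega>)}"
proof -
  have P': "{p. P p} \<in> sets config_space" using P by (simp add: pred_def)
  have "emeasure M {\<omega> \<in> space M. P (config \<omega>)} = emeasure law {p. P p}"
    unfolding law_def using P' by (subst emeasure_distr) (auto intro!: arg_cong[where f = "emeasure M"])
  also have "\<dots> = emeasure (distr law config_space (translate a)) {p. P p}"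
    by (simp only: distr_law_translate)
  also have "\<dots> = emeasure M {\<omega> \<in> space M. P (translate a (config \<omega>))}"
    unfolding law_def using P'
    by (subst distr_distr) (auto simp: emeasure_distr intro!: arg_cong[where f = "emeasure M"])
  finally show ?thesis by (simp add: measure_def)
qed

text \<open>Finite energy: given the weights and all other edges, \<open>e\<close> is present with probability \<open>edge_prob\<close>. Both sides are
  measures in the event \<open>P\<close>, and they agree on cylinders.\<close>

lemma emeasure_edge_insertion:
  assumes e: "e \<in> lattice_edges" and lam: "0 \<le> lam" and P: "Measurable.pred config_space P"
  shows "emeasure M {\<omega> \<in> space M. P (\<lambda>v. W v \<omega>, E \<omega> - {e}) \<and> e \<in> E \<omega>} =
    (\<integral>\<^sup>+\<omega>. ennreal (edge_prob (\<lambda>v. W v \<omega>) e) * indicator {\<omega> \<in> space M. P (\<lambda>v. W v \<omega>, E \<omega> - {e})} \<omega> \<partial>M)"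
proof -
  define X where "X = (\<lambda>\<omega>. (\<lambda>v. W v \<omega>, E \<omega> - {e}))"
  have X[measurable]: "X \<in> M \<rightarrow>\<^sub>M config_space"
    unfolding X_def by (intro measurable_config) auto
  have qm[measurable]: "(\<lambda>\<omega>. edge_prob (\<lambda>v. W v \<omega>) f) \<in> borel_measurable M" for f
    by (rule measurable_compose[OF measurable_W_space measurable_edge_prob])
  have q0: "AE \<omega> in M. \<forall>f. 0 \<le> edge_prob (\<lambda>v. W v \<omega>) f"
    using AE_weights_nonneg
    by eventually_elim (auto simp: edge_prob_def intro!: divide_nonneg_nonneg mult_nonneg_nonneg lam prod_nonneg)
  let ?q = "\<lambda>\<omega>. ennreal (edge_prob (\<lambda>v. W v \<omega>) e)"
  define N where "N = distr (density M (indicator {\<omega> \<in> space M. e \<in> E \<omega>})) config_space X"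
  define N' where "N' = distr (density M ?q) config_space X"
  have N: "emeasure N Y = emeasure M {\<omega> \<in> space M. X \<omega> \<in> Y \<and> e \<in> E \<omega>}"
    if Y[measurable]: "Y \<in> sets config_space" for Y
  proof -
    have "emeasure N Y = emeasure (density M (indicator {\<omega> \<in> space M. e \<in> E \<omega>})) (X -` Y \<inter> space M)"
      unfolding N_def by (subst emeasure_distr) auto
    also have "\<dots> = (\<integral>\<^sup>+\<omega>. indicator {\<omega> \<in> space M. e \<in> E \<omega>} \<omega> * indicator (X -` Y \<inter> space M) \<omega> \<partial>M)"
      by (rule emeasure_density) auto
    also have "\<dots> = (\<integral>\<^sup>+\<omega>. indicator {\<omega> \<in> space M. X \<omega> \<in> Y \<and> e \<in> E \<omega>} \<omega> \<partial>M)"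
      by (intro nn_integral_cong) (auto simp: indicator_def)
    finally show ?thesis by simp
  qed
  have N': "emeasure N' Y = (\<integral>\<^sup>+\<omega>. ?q \<omega> * indicator {\<omega> \<in> space M. X \<omega> \<in> Y} \<omega> \<partial>M)"
    if Y[measurable]: "Y \<in> sets config_space" for Y
  proof -
    have "emeasure N' Y = emeasure (density M ?q) (X -` Y \<inter> space M)"
      unfolding N'_def by (subst emeasure_distr) auto
    also have "\<dots> = (\<integral>\<^sup>+\<omega>. ?q \<omega> * indicator (X -` Y \<inter> space M) \<omega> \<partial>M)"
      by (rule emeasure_density) auto
    also have "\<dots> = (\<integral>\<^sup>+\<omega>. ?q \<omega> * indicator {\<omega> \<in> space M. X \<omega> \<in> Y} \<omega> \<partial>M)"
      by (intro nn_integral_cong) (auto simp: indicator_def)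
    finally show ?thesis .
  qed
  have "N = N'"
  proof (rule config_measure_eqI)
    show "finite_measure N"
    proof
      have "space N = UNIV" by (simp add: N_def)
      then show "emeasure N (space N) \<noteq> \<infinity>"
        using N[OF sets.top] by (simp add: emeasure_eq_measure)
    qed
  next
    fix A :: "((int ^ 'd) \<Rightarrow> real) set" and F :: "(int ^ 'd) set set"
    assume A[measurable]: "A \<in> sets weight_space" and F: "finite F"
    have Y: "A \<times> {G. F \<subseteq> G} \<in> sets config_space"
      using F by (auto simp: config_space_def up_set_in_edge_space)
    show "emeasure N (A \<times> {G. F \<subseteq> G}) = emeasure N' (A \<times> {G. F \<subseteq> G})"
    proof (cases "F \<subseteq> lattice_edges \<and> e \<notin> F")
      case False
      have no: "X \<omega> \<notin> A \<times> {G. F \<subseteq> G}" if \<omega>: "\<omega> \<in> space M" for \<omega>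
        using False edges_subset[OF \<omega>] by (auto simp: X_def)
      have "{\<omega> \<in> space M. X \<omega> \<in> A \<times> {G. F \<subseteq> G}} = {}"
        using no by (simp only: Collect_empty_eq) metis
      moreover have "{\<omega> \<in> space M. X \<omega> \<in> A \<times> {G. F \<subseteq> G} \<and> e \<in> E \<omega>} = {}"
        using no by (simp only: Collect_empty_eq) metis
      ultimately have "emeasure N (A \<times> {G. F \<subseteq> G}) = emeasure M {}"
          "emeasure N' (A \<times> {G. F \<subseteq> G}) = (\<integral>\<^sup>+\<omega>. ?q \<omega> * indicator ({} :: 'a set) \<omega> \<partial>M)"
        using N[OF Y] N'[OF Y] by (simp_all only:)
      then show ?thesis by simp
    next
      case True
      let ?I = "insert e F"
      have FM: "{\<omega> \<in> space M. F \<subseteq> E \<omega>} \<in> sets M" "{\<omega> \<in> space M. ?I \<subseteq> E \<omega>} \<in> sets M"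
      proof -
        have "Measurable.pred M (\<lambda>\<omega>. \<forall>e\<in>F. e \<in> E \<omega>)" "Measurable.pred M (\<lambda>\<omega>. \<forall>e\<in>?I. e \<in> E \<omega>)"
          using F by (intro pred_intros_finite; auto)+
        then show "{\<omega> \<in> space M. F \<subseteq> E \<omega>} \<in> sets M" "{\<omega> \<in> space M. ?I \<subseteq> E \<omega>} \<in> sets M"
          by (auto simp: pred_def subset_eq)
      qed
      have "emeasure N (A \<times> {G. F \<subseteq> G}) = emeasure M {\<omega> \<in> space M. X \<omega> \<in> A \<times> {G. F \<subseteq> G} \<and> e \<in> E \<omega>}"
        by (rule N[OF Y])
      also have "\<dots> = ennreal (\<integral>\<omega>. indicator {\<omega> \<in> space M. X \<omega> \<in> A \<times> {G. F \<subseteq> G} \<and> e \<in> E \<omega>} \<omega> \<partial>M)"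
        by (simp add: emeasure_eq_measure) (rule arg_cong[where f = prob], blast)
      also have "(\<integral>\<omega>. indicator {\<omega> \<in> space M. X \<omega> \<in> A \<times> {G. F \<subseteq> G} \<and> e \<in> E \<omega>} \<omega> \<partial>M) =
          ((\<integral>\<omega>. indicator A (\<lambda>v. W v \<omega>) * indicator {\<omega> \<in> space M. ?I \<subseteq> E \<omega>} \<omega> \<partial>M) :: real)"
        using True by (intro Bochner_Integration.integral_cong) (auto simp: indicator_def X_def)
      also have "\<dots> = (\<integral>\<omega>. indicator A (\<lambda>v. W v \<omega>) * (\<Prod>f\<in>?I. edge_prob (\<lambda>v. W v \<omega>) f) \<partial>M)"
        using True F e by (intro integral_edges[where B = 1]) (auto simp: indicator_def)
      \<comment> \<open>Weights are non-negative only almost surely, hence the truncation at 0.\<close>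
      also have "\<dots> = (\<integral>\<omega>. (indicator A (\<lambda>v. W v \<omega>) * max 0 (edge_prob (\<lambda>v. W v \<omega>) e)) *
          (\<Prod>f\<in>F. edge_prob (\<lambda>v. W v \<omega>) f) \<partial>M)"
        using q0 True F by (intro integral_cong_AE) (auto elim!: eventually_mono)
      also have "\<dots> = (\<integral>\<omega>. (indicator A (\<lambda>v. W v \<omega>) * max 0 (edge_prob (\<lambda>v. W v \<omega>) e)) *
          indicator {\<omega> \<in> space M. F \<subseteq> E \<omega>} \<omega> \<partial>M)"
        using True F e edge_prob_le_1 by (intro integral_edges[where B = 1, symmetric]) (auto simp: indicator_def)
      also have "ennreal \<dots> = (\<integral>\<^sup>+\<omega>. ennreal ((indicator A (\<lambda>v. W v \<omega>) * max 0 (edge_prob (\<lambda>v. W v \<omega>) e)) *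
          indicator {\<omega> \<in> space M. F \<subseteq> E \<omega>} \<omega>) \<partial>M)"
        using FM edge_prob_le_1
        by (intro nn_integral_eq_integral[symmetric] integrable_const_bound[of _ 1]) (auto simp: indicator_def)
      also have "\<dots> = (\<integral>\<^sup>+\<omega>. ?q \<omega> * indicator {\<omega> \<in> space M. X \<omega> \<in> A \<times> {G. F \<subseteq> G}} \<omega> \<partial>M)"
        using q0 True by (intro nn_integral_cong_AE) (auto elim!: eventually_mono simp: indicator_def X_def)
      also have "\<dots> = emeasure N' (A \<times> {G. F \<subseteq> G})" by (rule N'[OF Y, symmetric])
      finally show ?thesis .
    qed
  qed (auto simp: N_def N'_def)
  moreover have "{p. P p} \<in> sets config_space" using P by (simp add: pred_def)
  ultimately show ?thesis using N[of "{p. P p}"] N'[of "{p. P p}"] by (simp add: X_def)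
qed

end

section \<open>Missing edges and extreme weights\<close>

context scale_free_percolation
begin

abbreviation Wt :: "'a \<Rightarrow> (int ^ 'd) \<Rightarrow> real" where
  "Wt \<omega> \<equiv> (\<lambda>v. W v \<omega>)"

lemma pred_W_compose [measurable (raw)]:
  "Measurable.pred weight_space P \<Longrightarrow> Measurable.pred M (\<lambda>\<omega>. P (Wt \<omega>))"
  by (rule measurable_compose[OF measurable_W_space])

lemma edge_absent:
  assumes uv: "u \<noteq> v" and P: "Measurable.pred weight_space P" and s: "0 \<le> s"
    and rate: "\<And>w. P w \<Longrightarrow> s \<le> lam * w u * w v / lattice_norm (u - v) powr \<alpha>"
  shows "prob {\<omega> \<in> space M. P (Wt \<omega>) \<and> {u, v} \<notin> E \<omega>} \<le> exp (- s) * prob {\<omega> \<in> space M. P (Wt \<omega>)}"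
proof -
  let ?e = "{u, v}" and ?A = "{w. P w}"
  have A[measurable]: "?A \<in> sets weight_space" using P by (simp add: pred_def)
  have [measurable]: "Measurable.pred M (\<lambda>\<omega>. P (Wt \<omega>))" by (rule pred_W_compose[OF P])
  have e: "{?e} \<subseteq> lattice_edges" using uv by (auto simp: lattice_edges_def)
  have qm: "(\<lambda>\<omega>. edge_prob (Wt \<omega>) ?e) \<in> borel_measurable M"
    by (rule measurable_compose[OF measurable_W_space measurable_edge_prob])
  have q: "1 - exp (- s) \<le> edge_prob w ?e" if "P w" for w
    using rate[OF that] uv by (simp add: edge_prob_eq)
  have q01: "\<bar>indicator ?A w * edge_prob w ?e\<bar> \<le> 1" for w
  proof (cases "P w")
    case True
    have "0 \<le> 1 - exp (- s)" using s by simp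
    then have "0 \<le> edge_prob w ?e" using q[OF True] by linarith
    then show ?thesis using True edge_prob_le_1[of w ?e] by simp
  qed simp
  have "(1 - exp (- s)) * prob {\<omega> \<in> space M. P (Wt \<omega>)} =
      (\<integral>\<omega>. (1 - exp (- s)) * indicator {\<omega> \<in> space M. P (Wt \<omega>)} \<omega> \<partial>M)"
    by simp
  also have "\<dots> \<le> (\<integral>\<omega>. indicator ?A (Wt \<omega>) * edge_prob (Wt \<omega>) ?e \<partial>M)"
  proof (rule integral_mono)
    show "integrable M (\<lambda>\<omega>. indicator ?A (Wt \<omega>) * edge_prob (Wt \<omega>) ?e)"
      using q01 qm by (intro integrable_const_bound[of _ 1]) auto
    show "integrable M (\<lambda>\<omega>. (1 - exp (- s)) * indicator {\<omega> \<in> space M. P (Wt \<omega>)} \<omega>)"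
      by (intro integrable_mult_right integrable_real_indicator) (auto simp: emeasure_eq_measure)
    show "(1 - exp (- s)) * indicator {\<omega> \<in> space M. P (Wt \<omega>)} \<omega> \<le>
        indicator ?A (Wt \<omega>) * edge_prob (Wt \<omega>) ?e" if "\<omega> \<in> space M" for \<omega>
      using q[of "Wt \<omega>"] that by (cases "P (Wt \<omega>)") auto
  qed
  also have "\<dots> = (\<integral>\<omega>. indicator ?A (Wt \<omega>) * indicator {\<omega> \<in> space M. {?e} \<subseteq> E \<omega>} \<omega> \<partial>M)"
    using integral_edges[OF _ e, of "indicator ?A" 1] by simp
  also have "\<dots> = (\<integral>\<omega>. indicator {\<omega> \<in> space M. P (Wt \<omega>) \<and> ?e \<in> E \<omega>} \<omega> \<partial>M)"
    by (intro Bochner_Integration.integral_cong) (auto simp: indicator_def)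
  also have "\<dots> = prob {\<omega> \<in> space M. P (Wt \<omega>) \<and> ?e \<in> E \<omega>}"
    by simp
  finally have "(1 - exp (- s)) * prob {\<omega> \<in> space M. P (Wt \<omega>)} \<le> prob {\<omega> \<in> space M. P (Wt \<omega>) \<and> ?e \<in> E \<omega>}" .
  moreover have "prob ({\<omega> \<in> space M. P (Wt \<omega>) \<and> ?e \<in> E \<omega>} \<union> {\<omega> \<in> space M. P (Wt \<omega>) \<and> ?e \<notin> E \<omega>}) =
      prob {\<omega> \<in> space M. P (Wt \<omega>) \<and> ?e \<in> E \<omega>} + prob {\<omega> \<in> space M. P (Wt \<omega>) \<and> ?e \<notin> E \<omega>}"
    by (rule finite_measure_Union) auto
  moreover have "{\<omega> \<in> space M. P (Wt \<omega>) \<and> ?e \<in> E \<omega>} \<union> {\<omega> \<in> space M. P (Wt \<omega>) \<and> ?e \<notin> E \<omega>} =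
      {\<omega> \<in> space M. P (Wt \<omega>)}"
    by blast
  ultimately show ?thesis by (simp only: left_diff_distrib mult_1_left)
qed

text \<open>The end points may be chosen by looking at the weights, as the hubs are: sum the previous bound over
  their possible values.\<close>

lemma random_edge_absent:
  assumes P[measurable]: "Measurable.pred weight_space P" and s: "0 \<le> s" and R: "finite R"
    and U[measurable]: "U \<in> weight_space \<rightarrow>\<^sub>M count_space UNIV"
    and V[measurable]: "V \<in> weight_space \<rightarrow>\<^sub>M count_space UNIV"
    and range: "\<And>w. P w \<Longrightarrow> U w \<in> R \<and> V w \<in> R"
    and rate: "\<And>w. P w \<Longrightarrow> U w \<noteq> V w \<Longrightarrow>
      s \<le> lam * w (U w) * w (V w) / lattice_norm (U w - V w) powr \<alpha>"
  shows "prob {\<omega> \<in> space M. P (Wt \<omega>) \<and> \<not> adj_or_eq (E \<omega>) (U (Wt \<omega>)) (V (Wt \<omega>))}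
    \<le> exp (- s) * prob {\<omega> \<in> space M. P (Wt \<omega>)}"
proof -
  define Q where "Q = (\<lambda>(u, v) w. P w \<and> U w = u \<and> V w = v)"
  have Q[measurable]: "Measurable.pred weight_space (Q uv)" for uv
    unfolding Q_def by (cases uv) simp
  have QM: "{\<omega> \<in> space M. Q uv (Wt \<omega>)} \<in> events" for uv
    using pred_W_compose[OF Q[of uv]] by (simp add: pred_def)
  define S where "S = (R \<times> R) \<inter> {(u, v). u \<noteq> v}"
  have "prob {\<omega> \<in> space M. P (Wt \<omega>) \<and> \<not> adj_or_eq (E \<omega>) (U (Wt \<omega>)) (V (Wt \<omega>))} \<le>
      prob (\<Union>uv\<in>S. {\<omega> \<in> space M. Q uv (Wt \<omega>) \<and> {fst uv, snd uv} \<notin> E \<omega>})"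
  proof (rule finite_measure_mono)
    show "(\<Union>uv\<in>S. {\<omega> \<in> space M. Q uv (Wt \<omega>) \<and> {fst uv, snd uv} \<notin> E \<omega>}) \<in> events"
      using R by (intro sets.finite_UN) (auto simp: S_def)
    show "{\<omega> \<in> space M. P (Wt \<omega>) \<and> \<not> adj_or_eq (E \<omega>) (U (Wt \<omega>)) (V (Wt \<omega>))} \<subseteq>
        (\<Union>uv\<in>S. {\<omega> \<in> space M. Q uv (Wt \<omega>) \<and> {fst uv, snd uv} \<notin> E \<omega>})"
    proof
      fix \<omega> assume \<omega>: "\<omega> \<in> {\<omega> \<in> space M. P (Wt \<omega>) \<and> \<not> adj_or_eq (E \<omega>) (U (Wt \<omega>)) (V (Wt \<omega>))}"
      then show "\<omega> \<in> (\<Union>uv\<in>S. {\<omega> \<in> space M. Q uv (Wt \<omega>) \<and> {fst uv, snd uv} \<notin> E \<omega>})"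
        using range[of "Wt \<omega>"]
        by (intro UN_I[of "(U (Wt \<omega>), V (Wt \<omega>))"]) (auto simp: S_def Q_def adj_or_eq_def)
    qed
  qed
  also have "\<dots> \<le> (\<Sum>uv\<in>S. prob {\<omega> \<in> space M. Q uv (Wt \<omega>) \<and> {fst uv, snd uv} \<notin> E \<omega>})"
    using R by (intro finite_measure_subadditive_finite) (auto simp: S_def)
  also have "\<dots> \<le> (\<Sum>uv\<in>S. exp (- s) * prob {\<omega> \<in> space M. Q uv (Wt \<omega>)})"
    using rate by (intro sum_mono edge_absent s Q) (auto simp: S_def Q_def)
  also have "\<dots> = exp (- s) * (\<Sum>uv\<in>S. prob {\<omega> \<in> space M. Q uv (Wt \<omega>)})"
    by (simp add: sum_distrib_left)
  also have "(\<Sum>uv\<in>S. prob {\<omega> \<in> space M. Q uv (Wt \<omega>)}) = prob (\<Union>uv\<in>S. {\<omega> \<in> space M. Q uv (Wt \<omega>)})"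
    using R QM by (intro finite_measure_finite_Union[symmetric])
      (auto simp: S_def Q_def disjoint_family_on_def)
  also have "exp (- s) * \<dots> \<le> exp (- s) * prob {\<omega> \<in> space M. P (Wt \<omega>)}"
    by (intro mult_left_mono finite_measure_mono) (auto simp: Q_def pred_W_compose)
  finally show ?thesis by simp
qed

lemma prob_weights_product:
  assumes J: "finite J" and S: "\<And>y. y \<in> J \<Longrightarrow> S y \<in> sets borel"
  shows "prob {\<omega> \<in> space M. \<forall>y\<in>J. W y \<omega> \<in> S y} = (\<Prod>y\<in>J. measure \<mu> (S y))"
proof (cases "J = {}")
  case True then show ?thesis by (simp add: prob_space)
next
  case False
  have "prob (\<Inter>y\<in>J. W y -` S y \<inter> space M) = (\<Prod>y\<in>J. prob (W y -` S y \<inter> space M))"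
    using indep_varsD[OF weights_indep, of J S] J S False by auto
  also have "\<dots> = (\<Prod>y\<in>J. measure \<mu> (S y))"
  proof (rule prod.cong[OF refl])
    fix y assume "y \<in> J"
    then show "prob (W y -` S y \<inter> space M) = measure \<mu> (S y)"
      using S by (simp add: weights_law[of y, symmetric] measure_distr)
  qed
  also have "(\<Inter>y\<in>J. W y -` S y \<inter> space M) = {\<omega> \<in> space M. \<forall>y\<in>J. W y \<omega> \<in> S y}"
    using False by auto
  finally show ?thesis .
qed

end

lemma lattice_norm_le: "(\<And>i. \<bar>real_of_int (x $ i)\<bar> \<le> r) \<Longrightarrow> lattice_norm (x :: int ^ 'd) \<le> real CARD('d) * r"
  using norm_le_l1_cart[of "\<chi> i. real_of_int (x $ i)"] sum_bounded_above[of UNIV "\<lambda>i. \<bar>real_of_int (x $ i)\<bar>" r]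
  by (simp add: lattice_norm_def)

lemma component_le_lattice_norm: "\<bar>real_of_int (x $ i)\<bar> \<le> lattice_norm x"
  using component_le_norm_cart[of "\<chi> i. real_of_int (x $ i)" i] by (simp add: lattice_norm_def)

section \<open>Hubs\<close>

text \<open>In a cube of side \<open>r\<close> the largest weight has at least the order \<open>r\<close> to the power \<open>d / p\<close>, where \<open>p = \<tau> - 1\<close>. The exponent \<open>a\<close> stays
  slightly below this, so that a weight \<open>r powr a\<close> is found with overwhelming probability. The exponent \<open>\<beta>\<close> is the
  growth of the scales. Two vertices of weights \<open>r powr a\<close> and \<open>r powr (a * \<beta>)\<close> at distance \<open>r powr \<beta>\<close> are
  connected at rate \<open>r powr (a * (1 + \<beta>) - \<alpha> * \<beta>)\<close>, which is large exactly when \<open>link_exponent\<close> holds.\<close>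

locale hub_percolation = scale_free_percolation M W E \<mu> lam \<alpha>
  for M :: "'a measure" and W :: "int ^ 'd \<Rightarrow> 'a \<Rightarrow> real" and E :: "'a \<Rightarrow> (int ^ 'd) set set"
    and \<mu> lam \<alpha> +
  fixes p c a \<beta> :: real
  assumes lam_pos: "0 < lam" and alpha_pos: "0 < \<alpha>" and p_pos: "0 < p" and c_pos: "0 < c"
    and tail: "\<And>t. 1 \<le> t \<Longrightarrow> c * t powr (- p) \<le> measure \<mu> {t<..}"
    and beta: "1 < \<beta>" and a_pos: "0 < a"
    and hub_exponent: "a * p < real CARD('d)"
    and link_exponent: "\<alpha> * \<beta> < a * (1 + \<beta>)"
begin

definition radius :: "nat \<Rightarrow> real" where "radius k = 2 powr (\<beta> ^ k)"

definition level :: "nat \<Rightarrow> real" where "level k = radius k powr a"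

definition cube :: "nat \<Rightarrow> (int ^ 'd) set" where
  "cube k = {z. \<forall>i. \<bar>real_of_int (z $ i)\<bar> \<le> radius k}"

definition found :: "((int ^ 'd) \<Rightarrow> real) \<Rightarrow> (int ^ 'd) \<Rightarrow> nat \<Rightarrow> bool" where
  "found w v k \<longleftrightarrow> (\<exists>z. z \<in> cube k \<and> level k < w (v + z))"

text \<open>The hub of scale \<open>k\<close> around \<open>v\<close> is the first vertex of weight above \<open>level k\<close> in a fixed enumeration of displacements.
  Taking a first vertex instead of a heaviest one avoids ties, and enumerating displacements
  instead of vertices makes the choice commute with translations. Without such a vertex the value is arbitrary.\<close>

definition hub :: "((int ^ 'd) \<Rightarrow> real) \<Rightarrow> (int ^ 'd) \<Rightarrow> nat \<Rightarrow> int ^ 'd" where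
  "hub w v k = v + from_nat (LEAST n. from_nat n \<in> cube k \<and> level k < w (v + from_nat n))"

lemma radius_Suc: "radius (Suc k) = radius k powr \<beta>"
  by (simp add: radius_def powr_powr mult.commute)

lemma beta_power_ge: "1 + real k * (\<beta> - 1) \<le> \<beta> ^ k"
  using Bernoulli_inequality[of "\<beta> - 1" k] beta by simp

lemma radius_gt_1: "1 < radius k"
  unfolding radius_def using beta by (intro gr_one_powr) auto

lemma radius_pos: "0 < radius k" using radius_gt_1[of k] by simp

lemma radius_mono: "i \<le> j \<Longrightarrow> radius i \<le> radius j"
  unfolding radius_def using beta by (intro powr_mono power_increasing) auto

lemma radius_at_top: "filterlim radius at_top sequentially"
proof -
  have "filterlim (\<lambda>k. real k * (\<beta> - 1)) at_top sequentially"
    using beta by (intro filterlim_at_top_mult_tendsto_pos[OF tendsto_const] filterlim_real_sequentially) auto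
  then have "filterlim (\<lambda>k. \<beta> ^ k) at_top sequentially"
    by (rule filterlim_at_top_mono)
      (use beta_power_ge in \<open>auto intro!: always_eventually order_trans[OF _ beta_power_ge]\<close>)
  then have "filterlim (\<lambda>k. exp (ln 2 * \<beta> ^ k)) at_top sequentially"
    by (intro filterlim_compose[OF exp_at_top] filterlim_tendsto_pos_mult_at_top[OF tendsto_const]) auto
  moreover have "radius = (\<lambda>k. exp (ln 2 * \<beta> ^ k))"
    by (auto simp: radius_def powr_def fun_eq_iff)
  ultimately show ?thesis by simp
qed

text \<open>Since \<open>exp (- y) \<le> 1 / y\<close> and \<open>\<beta> ^ k\<close> grows at least linearly, a geometric series dominates.\<close>

lemma summable_radius: assumes "0 < C" "0 < \<kappa>" shows "summable (\<lambda>k. exp (- C * radius k powr \<kappa>))"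
proof (rule summable_comparison_test')
  define q where "q = 2 powr (- \<kappa> * (\<beta> - 1))"
  have "q < 2 powr 0" unfolding q_def using assms beta by (intro powr_less_mono) auto
  then have q: "0 < q" "q < 1" by (auto simp: q_def)
  then show "summable (\<lambda>k. (1 / C) * q ^ k)" by (intro summable_mult summable_geometric) auto
  fix k :: nat assume "0 \<le> k"
  let ?y = "C * radius k powr \<kappa>"
  have y: "0 < ?y" using assms radius_pos[of k] by simp
  have "?y \<le> exp ?y" using exp_ge_add_one_self[of ?y] by linarith
  then have "exp (- ?y) \<le> 1 / ?y" using y by (simp add: exp_minus field_simps)
  also have "1 / ?y = (1 / C) * radius k powr (- \<kappa>)" by (simp add: powr_minus field_simps)
  also have "radius k powr (- \<kappa>) \<le> q ^ k"
  proof -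
    have "radius k powr (- \<kappa>) = 2 powr (- \<kappa> * \<beta> ^ k)" by (simp add: radius_def powr_powr mult.commute)
    also have "\<dots> \<le> 2 powr (- \<kappa> * (\<beta> - 1) * real k)"
    proof (rule powr_mono)
      have "(\<beta> - 1) * real k \<le> \<beta> ^ k" using beta_power_ge[of k] by (simp add: mult.commute)
      then have "\<kappa> * ((\<beta> - 1) * real k) \<le> \<kappa> * \<beta> ^ k" using assms by (intro mult_left_mono) auto
      then show "- \<kappa> * \<beta> ^ k \<le> - \<kappa> * (\<beta> - 1) * real k" by (simp add: algebra_simps)
    qed simp
    also have "\<dots> = q ^ k" using q(1) by (simp add: powr_realpow[symmetric] q_def powr_powr)
    finally show ?thesis .
  qed
  finally show "norm (exp (- C * radius k powr \<kappa>)) \<le> (1 / C) * q ^ k"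
    using assms by (simp add: divide_right_mono)
qed

lemma cube_eq: "cube k = (\<lambda>f. \<chi> i. f i) ` (UNIV \<rightarrow>\<^sub>E {- \<lfloor>radius k\<rfloor>..\<lfloor>radius k\<rfloor>})"
proof -
  have *: "\<bar>real_of_int z\<bar> \<le> radius k \<longleftrightarrow> z \<in> {- \<lfloor>radius k\<rfloor>..\<lfloor>radius k\<rfloor>}" for z :: int
    by (auto simp: abs_le_iff le_floor_iff minus_le_iff)
  show ?thesis
  proof (rule set_eqI, rule iffI)
    fix z assume "z \<in> cube k"
    then have "(\<lambda>i. z $ i) \<in> UNIV \<rightarrow>\<^sub>E {- \<lfloor>radius k\<rfloor>..\<lfloor>radius k\<rfloor>}" by (auto simp: cube_def *)
    then show "z \<in> (\<lambda>f. \<chi> i. f i) ` (UNIV \<rightarrow>\<^sub>E {- \<lfloor>radius k\<rfloor>..\<lfloor>radius k\<rfloor>})"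
      by (intro image_eqI[of _ _ "\<lambda>i. z $ i"]) auto
  qed (auto simp: cube_def *)
qed

lemma finite_cube: "finite (cube k)"
  unfolding cube_eq by (intro finite_imageI finite_PiE) auto

lemma card_cube: "radius k ^ CARD('d) \<le> real (card (cube k))"
proof -
  have "card (cube k) = card ((UNIV :: 'd set) \<rightarrow>\<^sub>E {- \<lfloor>radius k\<rfloor>..\<lfloor>radius k\<rfloor>})"
    unfolding cube_eq by (rule card_image) (auto simp: inj_on_def vec_eq_iff)
  also have "\<dots> = nat (2 * \<lfloor>radius k\<rfloor> + 1) ^ CARD('d)"
    by (simp add: card_PiE algebra_simps)
  finally have "real (card (cube k)) = real (nat (2 * \<lfloor>radius k\<rfloor> + 1)) ^ CARD('d)" by simp
  moreover have "radius k \<le> real (nat (2 * \<lfloor>radius k\<rfloor> + 1))"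
    using radius_gt_1[of k] by linarith
  ultimately show ?thesis using radius_pos[of k] by (simp add: power_mono)
qed

lemma found_hub:
  assumes "found w v k"
  shows "level k < w (hub w v k)" "hub w v k - v \<in> cube k"
proof -
  let ?P = "\<lambda>n. from_nat n \<in> cube k \<and> level k < w (v + from_nat n)"
  from assms obtain z where "z \<in> cube k" "level k < w (v + z)" by (auto simp: found_def)
  then have "?P (to_nat z)" by simp
  then have "?P (LEAST n. ?P n)" by (rule LeastI)
  then show "level k < w (hub w v k)" "hub w v k - v \<in> cube k" by (auto simp: hub_def)
qed

lemma pred_found [measurable]: "Measurable.pred weight_space (\<lambda>w. found w v k)"
  unfolding found_def by measurable

lemma measurable_hub [measurable]: "(\<lambda>w. hub w v k) \<in> weight_space \<rightarrow>\<^sub>M count_space UNIV"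
  unfolding hub_def by measurable

text \<open>The bounds below are needed unconditionally (\<open>J = {}\<close>) and on the event that two given vertices have huge weight.
  They are therefore stated relative to \<open>heavy J T\<close> throughout.\<close>

definition heavy :: "(int ^ 'd) set \<Rightarrow> real \<Rightarrow> ((int ^ 'd) \<Rightarrow> real) \<Rightarrow> bool" where
  "heavy J T w \<longleftrightarrow> (\<forall>y\<in>J. T < w y)"

lemma pred_heavy [measurable]: "finite J \<Longrightarrow> Measurable.pred weight_space (heavy J T)"
  unfolding heavy_def by (intro pred_intros_finite) auto

text \<open>The factor \<open>exp (2 * c)\<close> pays for up to two vertices of the cube that are excluded because their weights are
  prescribed.\<close>

definition hub_err :: "nat \<Rightarrow> real" where
  "hub_err k = exp (2 * c) * exp (- c * radius k powr (real CARD('d) - a * p))"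

lemma level_ge_1: "1 \<le> level k"
  unfolding level_def using radius_gt_1[of k] a_pos by (intro ge_one_powr_ge_zero) auto

text \<open>The weights outside \<open>J\<close> are independent of those in \<open>J\<close>, and about \<open>radius k ^ d\<close> of them would all have to
  stay below \<open>level k\<close>, each exceeding it with probability at least \<open>c * level k powr - p\<close>.\<close>

lemma prob_not_found:
  assumes J: "finite J" "card J \<le> 2"
  shows "prob {\<omega> \<in> space M. heavy J T (Wt \<omega>) \<and> \<not> found (Wt \<omega>) v k}
    \<le> hub_err k * prob {\<omega> \<in> space M. heavy J T (Wt \<omega>)}"
proof -
  interpret mu: prob_space \<mu> by (rule prob_space_mu)
  define B where "B = (\<lambda>z. v + z) ` cube k - J"
  have B: "finite B" using finite_cube by (simp add: B_def)
  define S where "S = (\<lambda>y. if y \<in> J then {T<..} else {..level k})"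
  let ?x = "c * level k powr (- p)"
  have small: "measure \<mu> {..level k} \<le> exp (- ?x)"
  proof -
    have "space \<mu> = UNIV" using sets_eq_imp_space_eq[OF sets_mu] by simp
    then have "{..level k} = space \<mu> - {level k<..}" by auto
    then have "measure \<mu> {..level k} = 1 - measure \<mu> {level k<..}"
      by (simp add: mu.prob_compl)
    also have "\<dots> \<le> 1 - ?x" using tail[OF level_ge_1[of k]] by simp
    also have "\<dots> \<le> exp (- ?x)" using exp_ge_add_one_self[of "- ?x"] by simp
    finally show ?thesis .
  qed
  have cardB: "radius k ^ CARD('d) - 2 \<le> real (card B)"
  proof -
    have "card ((\<lambda>z. v + z) ` cube k) = card (cube k)" by (intro card_image) (auto simp: inj_on_def)
    moreover have "card ((\<lambda>z. v + z) ` cube k) - card J \<le> card B"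
      unfolding B_def using J by (intro diff_card_le_card_Diff)
    ultimately have "card (cube k) \<le> card B + 2" using J by linarith
    then have "real (card (cube k)) \<le> real (card B) + 2" by linarith
    then show ?thesis using card_cube[of k] by linarith
  qed
  have "prob {\<omega> \<in> space M. heavy J T (Wt \<omega>) \<and> \<not> found (Wt \<omega>) v k} \<le>
      prob {\<omega> \<in> space M. \<forall>y\<in>J \<union> B. W y \<omega> \<in> S y}"
  proof (rule finite_measure_mono)
    have "Measurable.pred M (\<lambda>\<omega>. \<forall>y\<in>J \<union> B. W y \<omega> \<in> S y)"
      using J B by (intro pred_intros_finite) (auto simp: S_def)
    then show "{\<omega> \<in> space M. \<forall>y\<in>J \<union> B. W y \<omega> \<in> S y} \<in> events" by (simp add: pred_def)
  qed (auto simp: S_def B_def heavy_def found_def not_less)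
  also have "\<dots> = (\<Prod>y\<in>J \<union> B. measure \<mu> (S y))"
    using J B by (intro prob_weights_product) (auto simp: S_def)
  also have "\<dots> = (\<Prod>y\<in>J. measure \<mu> {T<..}) * (\<Prod>y\<in>B. measure \<mu> {..level k})"
    using J B by (subst prod.union_disjoint) (auto simp: B_def S_def)
  also have "(\<Prod>y\<in>J. measure \<mu> {T<..}) = prob {\<omega> \<in> space M. heavy J T (Wt \<omega>)}"
    using prob_weights_product[of J "\<lambda>_. {T<..}"] J by (simp add: heavy_def)
  finally have *: "prob {\<omega> \<in> space M. heavy J T (Wt \<omega>) \<and> \<not> found (Wt \<omega>) v k} \<le>
    prob {\<omega> \<in> space M. heavy J T (Wt \<omega>)} * (\<Prod>y\<in>B. measure \<mu> {..level k})" .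
  have "(\<Prod>y\<in>B. measure \<mu> {..level k}) \<le> hub_err k"
  proof -
    have "(\<Prod>y\<in>B. measure \<mu> {..level k}) \<le> exp (- ?x) ^ card B"
      using small by (simp add: power_mono)
    also have "\<dots> = exp (- ?x * real (card B))" by (simp add: exp_of_nat_mult[symmetric] mult.commute)
    also have "\<dots> \<le> exp (- ?x * (radius k ^ CARD('d) - 2))"
      using cardB c_pos by (simp add: mult_left_mono)
    also have "\<dots> = exp (2 * ?x) * exp (- c * (level k powr (- p) * radius k ^ CARD('d)))"
      by (simp add: exp_add[symmetric] algebra_simps)
    also have "level k powr (- p) * radius k ^ CARD('d) = radius k powr (real CARD('d) - a * p)"
      using radius_pos[of k]
      by (simp add: level_def powr_powr powr_realpow[symmetric] powr_add[symmetric])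
    also have "exp (2 * ?x) \<le> exp (2 * c)"
    proof -
      have "level k powr (- p) \<le> level k powr 0"
        using level_ge_1[of k] p_pos by (intro powr_mono) auto
      then show ?thesis using c_pos level_ge_1[of k] by (simp add: mult_left_le)
    qed
    finally show ?thesis by (simp add: hub_err_def mult_right_mono)
  qed
  then have "prob {\<omega> \<in> space M. heavy J T (Wt \<omega>)} * (\<Prod>y\<in>B. measure \<mu> {..level k}) \<le>
      prob {\<omega> \<in> space M. heavy J T (Wt \<omega>)} * hub_err k"
    by (intro mult_left_mono) auto
  with * show ?thesis by (simp add: mult.commute)
qed

section \<open>Adjacency of hubs\<close>

lemma rate_split: "l * x * y / (A * B) = l / A * (x * y / B)" for l x y A B :: real
  by simp

lemma link_rate:
  fixes u v :: "int ^ 'd"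
  assumes u: "level i < w u" "level j < w v" "u \<noteq> v" and r: "0 < r"
    and near: "\<And>l. \<bar>real_of_int ((u - v) $ l)\<bar> \<le> r"
  shows "lam * level i * level j / (real CARD('d) * r) powr \<alpha> \<le> lam * w u * w v / lattice_norm (u - v) powr \<alpha>"
proof (rule frac_le)
  have pos: "0 < level i" "0 < level j" using level_ge_1[of i] level_ge_1[of j] by auto
  show "lam * level i * level j \<le> lam * w u * w v"
    using u pos lam_pos by (intro mult_mono) auto
  show "0 \<le> lam * w u * w v"
    using u pos lam_pos by (intro mult_nonneg_nonneg) auto
  show "0 < lattice_norm (u - v) powr \<alpha>" using lattice_norm_pos[OF u(3)] by simp
  show "lattice_norm (u - v) powr \<alpha> \<le> (real CARD('d) * r) powr \<alpha>"
    using lattice_norm_le[OF near] alpha_pos lattice_norm_pos[OF u(3)] by (intro powr_mono2) auto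
qed

lemma mem_translate_cube: "u - v \<in> cube k \<Longrightarrow> u \<in> (\<lambda>z. v + z) ` cube k"
  by (rule image_eqI[of _ _ "u - v"]) auto

lemma cube_mono: "i \<le> j \<Longrightarrow> cube i \<subseteq> cube j"
  unfolding cube_def by (auto intro: order_trans[OF _ radius_mono])

definition linked :: "((int ^ 'd) \<Rightarrow> real) \<times> (int ^ 'd) set set \<Rightarrow> (int ^ 'd) \<Rightarrow> nat \<Rightarrow> bool" where
  "linked x v k \<longleftrightarrow> adj_or_eq (snd x) (hub (fst x) v k) (hub (fst x) v (Suc k))"

definition crossed :: "((int ^ 'd) \<Rightarrow> real) \<times> (int ^ 'd) set set \<Rightarrow> (int ^ 'd) \<Rightarrow> (int ^ 'd) \<Rightarrow> nat \<Rightarrow> bool" where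
  "crossed x v v' k \<longleftrightarrow> adj_or_eq (snd x) (hub (fst x) v k) (hub (fst x) v' k)"

lemma pred_adj_or_eq [measurable (raw)]:
  assumes [measurable]: "f \<in> N \<rightarrow>\<^sub>M count_space UNIV" "g \<in> N \<rightarrow>\<^sub>M count_space UNIV"
    "\<And>e. Measurable.pred N (\<lambda>x. e \<in> G x)"
  shows "Measurable.pred N (\<lambda>x. adj_or_eq (G x) (f x :: int ^ 'd) (g x))"
proof -
  have "adj_or_eq (G x) (f x) (g x) \<longleftrightarrow> (\<exists>u v. f x = u \<and> g x = v \<and> (u = v \<or> {u, v} \<in> G x))" for x
    by (auto simp: adj_or_eq_def)
  then show ?thesis by simp
qed

lemma measurable_hub_config [measurable]: "(\<lambda>x. hub (fst x) v k) \<in> config_space \<rightarrow>\<^sub>M count_space UNIV"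
  by (rule measurable_compose[OF measurable_fst_config measurable_hub])

lemma pred_found_config [measurable]: "Measurable.pred config_space (\<lambda>x. found (fst x) v k)"
  by (rule measurable_compose[OF measurable_fst_config pred_found])

lemma pred_linked [measurable]: "Measurable.pred config_space (\<lambda>x. linked x v k)"
  unfolding linked_def by measurable

lemma pred_crossed [measurable]: "Measurable.pred config_space (\<lambda>x. crossed x v v' k)"
  unfolding crossed_def by measurable

lemma pred_config_compose [measurable (raw)]:
  "Measurable.pred config_space P \<Longrightarrow> Measurable.pred M (\<lambda>\<omega>. P (config \<omega>))"
  by (rule measurable_compose[OF measurable_config_M])

definition link_err :: "nat \<Rightarrow> real" where
  "link_err k = exp (- (lam / (2 * real CARD('d)) powr \<alpha>) * radius k powr (a * (1 + \<beta>) - \<alpha> * \<beta>))"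

definition cross_err :: "nat \<Rightarrow> real" where
  "cross_err k = exp (- (lam / (3 * real CARD('d)) powr \<alpha>) * radius k powr (2 * a - \<alpha>))"

definition err :: "nat \<Rightarrow> real" where
  "err k = 2 * hub_err k + hub_err (Suc k) + link_err k + cross_err k"

lemma err_nonneg: "0 \<le> hub_err k" "0 \<le> link_err k" "0 \<le> cross_err k" "0 \<le> err k"
  by (auto simp: err_def hub_err_def link_err_def cross_err_def)

text \<open>The second inequality between exponents comes for free because \<open>\<beta> > 1\<close>. It is what lets two hubs of the same scale
  be adjacent.\<close>

lemma cross_exponent: "\<alpha> < 2 * a"
proof -
  have "\<alpha> * (1 + \<beta>) \<le> 2 * (\<alpha> * \<beta>)" using beta alpha_pos by (simp add: algebra_simps)
  also have "\<dots> < 2 * (a * (1 + \<beta>))" using link_exponent by simp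
  finally have "\<alpha> * (1 + \<beta>) < (2 * a) * (1 + \<beta>)" by simp
  then show ?thesis using beta by simp
qed

lemma summable_err: "summable err"
proof -
  have d: "0 < real CARD('d)" by simp
  have h: "summable hub_err"
    unfolding hub_err_def using hub_exponent c_pos by (intro summable_mult summable_radius) auto
  moreover have "summable (\<lambda>k. hub_err (Suc k))" using h by (subst summable_Suc_iff)
  moreover have "summable link_err"
    unfolding link_err_def using link_exponent lam_pos by (intro summable_radius) auto
  moreover have "summable cross_err"
    unfolding cross_err_def using cross_exponent lam_pos by (intro summable_radius) auto
  ultimately show ?thesis unfolding err_def by (intro summable_add summable_mult)
qed

lemma prob_split3:
  assumes "prob {\<omega> \<in> space M. Q \<omega> \<and> \<not> A \<omega>} \<le> x * q" "prob {\<omega> \<in> space M. Q \<omega> \<and> \<not> B \<omega>} \<le> y * q"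
    "prob {\<omega> \<in> space M. (Q \<omega> \<and> A \<omega> \<and> B \<omega>) \<and> \<not> C \<omega>} \<le> z * q"
    and [measurable]: "Measurable.pred M Q" "Measurable.pred M A" "Measurable.pred M B" "Measurable.pred M C"
  shows "prob {\<omega> \<in> space M. Q \<omega> \<and> \<not> C \<omega>} \<le> (x + y + z) * q"
proof -
  have "prob {\<omega> \<in> space M. Q \<omega> \<and> \<not> C \<omega>} \<le> prob ({\<omega> \<in> space M. Q \<omega> \<and> \<not> A \<omega>} \<union>
      ({\<omega> \<in> space M. Q \<omega> \<and> \<not> B \<omega>} \<union> {\<omega> \<in> space M. (Q \<omega> \<and> A \<omega> \<and> B \<omega>) \<and> \<not> C \<omega>}))"
    by (intro finite_measure_mono) auto
  also have "\<dots> \<le> prob {\<omega> \<in> space M. Q \<omega> \<and> \<not> A \<omega>} + prob ({\<omega> \<in> space M. Q \<omega> \<and> \<not> B \<omega>} \<union>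
      {\<omega> \<in> space M. (Q \<omega> \<and> A \<omega> \<and> B \<omega>) \<and> \<not> C \<omega>})"
    by (intro measure_Un_le) auto
  also have "prob ({\<omega> \<in> space M. Q \<omega> \<and> \<not> B \<omega>} \<union> {\<omega> \<in> space M. (Q \<omega> \<and> A \<omega> \<and> B \<omega>) \<and> \<not> C \<omega>}) \<le>
      prob {\<omega> \<in> space M. Q \<omega> \<and> \<not> B \<omega>} + prob {\<omega> \<in> space M. (Q \<omega> \<and> A \<omega> \<and> B \<omega>) \<and> \<not> C \<omega>}"
    by (intro measure_Un_le) auto
  finally show ?thesis using assms(1-3) by (simp add: algebra_simps)
qed

lemma prob_mono_factor: "x * prob A \<le> y * prob A" if "x \<le> y"
  using that by (intro mult_right_mono) auto

lemma prob_not_linked: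
  assumes J: "finite J" "card J \<le> 2"
  shows "prob {\<omega> \<in> space M. heavy J T (Wt \<omega>) \<and> \<not> linked (config \<omega>) v k}
    \<le> err k * prob {\<omega> \<in> space M. heavy J T (Wt \<omega>)}"
proof -
  let ?q = "prob {\<omega> \<in> space M. heavy J T (Wt \<omega>)}"
  let ?P = "\<lambda>w. heavy J T w \<and> found w v k \<and> found w v (Suc k)"
  let ?s = "lam * level k * level (Suc k) / (real CARD('d) * (2 * radius (Suc k))) powr \<alpha>"
  note [measurable] = pred_heavy[OF J(1)]
  have P: "Measurable.pred weight_space ?P" by measurable
  have "prob {\<omega> \<in> space M. ?P (Wt \<omega>) \<and> \<not> adj_or_eq (E \<omega>) (hub (Wt \<omega>) v k) (hub (Wt \<omega>) v (Suc k))}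
      \<le> exp (- ?s) * prob {\<omega> \<in> space M. ?P (Wt \<omega>)}"
  proof (rule random_edge_absent[OF P, where R = "(\<lambda>z. v + z) ` cube (Suc k)"])
    fix w assume w: "?P w"
    have kk: "hub w v k - v \<in> cube (Suc k)" "hub w v (Suc k) - v \<in> cube (Suc k)"
      using found_hub(2)[of w v k] found_hub(2)[of w v "Suc k"] w cube_mono[of k "Suc k"] by auto
    then show "hub w v k \<in> (\<lambda>z. v + z) ` cube (Suc k) \<and> hub w v (Suc k) \<in> (\<lambda>z. v + z) ` cube (Suc k)"
      by (auto dest: mem_translate_cube)
    assume ne: "hub w v k \<noteq> hub w v (Suc k)"
    have "\<bar>real_of_int ((hub w v k - hub w v (Suc k)) $ l)\<bar> \<le> 2 * radius (Suc k)" for l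
    proof -
      have "\<bar>real_of_int ((hub w v k - v) $ l)\<bar> \<le> radius (Suc k)"
          "\<bar>real_of_int ((hub w v (Suc k) - v) $ l)\<bar> \<le> radius (Suc k)"
        using kk by (auto simp: cube_def)
      then show ?thesis by (simp add: abs_le_iff)
    qed
    then show "?s \<le> lam * w (hub w v k) * w (hub w v (Suc k)) / lattice_norm (hub w v k - hub w v (Suc k)) powr \<alpha>"
      using w ne radius_pos[of "Suc k"] by (intro link_rate found_hub) auto
  qed (use lam_pos finite_cube level_ge_1[of k] level_ge_1[of "Suc k"] in auto)
  also have "exp (- ?s) = link_err k"
  proof -
    have 1: "level k * level (Suc k) / radius (Suc k) powr \<alpha> = radius k powr (a * (1 + \<beta>) - \<alpha> * \<beta>)"
      using radius_pos[of k]
      by (simp add: level_def radius_Suc powr_powr powr_add[symmetric] powr_diff[symmetric] algebra_simps)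
    have 2: "(real CARD('d) * (2 * radius (Suc k))) powr \<alpha> = (2 * real CARD('d)) powr \<alpha> * radius (Suc k) powr \<alpha>"
      using radius_pos[of "Suc k"] by (simp add: powr_mult mult_ac)
    show ?thesis unfolding 2 rate_split 1 link_err_def by simp
  qed
  also have "link_err k * prob {\<omega> \<in> space M. ?P (Wt \<omega>)} \<le> link_err k * ?q"
    by (intro mult_left_mono finite_measure_mono err_nonneg) auto
  finally have l: "prob {\<omega> \<in> space M. ?P (Wt \<omega>) \<and> \<not> linked (config \<omega>) v k} \<le> link_err k * ?q"
    by (simp add: linked_def)
  have "prob {\<omega> \<in> space M. heavy J T (Wt \<omega>) \<and> \<not> linked (config \<omega>) v k} \<le>
      (hub_err k + hub_err (Suc k) + link_err k) * ?q"
    by (rule prob_split3[OF prob_not_found[OF J] prob_not_found[OF J] l]) auto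
  also have "\<dots> \<le> err k * ?q" using err_nonneg[of k] by (intro prob_mono_factor) (simp add: err_def)
  finally show ?thesis .
qed

lemma prob_not_crossed:
  assumes J: "finite J" "card J \<le> 2" and vv: "lattice_norm (v - v') \<le> radius k"
  shows "prob {\<omega> \<in> space M. heavy J T (Wt \<omega>) \<and> \<not> crossed (config \<omega>) v v' k}
    \<le> err k * prob {\<omega> \<in> space M. heavy J T (Wt \<omega>)}"
proof -
  let ?q = "prob {\<omega> \<in> space M. heavy J T (Wt \<omega>)}"
  let ?P = "\<lambda>w. heavy J T w \<and> found w v k \<and> found w v' k"
  let ?s = "lam * level k * level k / (real CARD('d) * (3 * radius k)) powr \<alpha>"
  note [measurable] = pred_heavy[OF J(1)]
  have P: "Measurable.pred weight_space ?P" by measurable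
  have "prob {\<omega> \<in> space M. ?P (Wt \<omega>) \<and> \<not> adj_or_eq (E \<omega>) (hub (Wt \<omega>) v k) (hub (Wt \<omega>) v' k)}
      \<le> exp (- ?s) * prob {\<omega> \<in> space M. ?P (Wt \<omega>)}"
  proof (rule random_edge_absent[OF P, where R = "(\<lambda>z. v + z) ` cube k \<union> (\<lambda>z. v' + z) ` cube k"])
    fix w assume w: "?P w"
    have kk: "hub w v k - v \<in> cube k" "hub w v' k - v' \<in> cube k"
      using found_hub(2)[of w v k] found_hub(2)[of w v' k] w by auto
    then show "hub w v k \<in> (\<lambda>z. v + z) ` cube k \<union> (\<lambda>z. v' + z) ` cube k \<and>
        hub w v' k \<in> (\<lambda>z. v + z) ` cube k \<union> (\<lambda>z. v' + z) ` cube k"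
      by (auto dest: mem_translate_cube)
    assume ne: "hub w v k \<noteq> hub w v' k"
    have "\<bar>real_of_int ((hub w v k - hub w v' k) $ l)\<bar> \<le> 3 * radius k" for l
    proof -
      have "\<bar>real_of_int ((hub w v k - v) $ l)\<bar> \<le> radius k"
          "\<bar>real_of_int ((hub w v' k - v') $ l)\<bar> \<le> radius k"
          "\<bar>real_of_int ((v - v') $ l)\<bar> \<le> radius k"
        using kk vv component_le_lattice_norm[of "v - v'" l] by (auto simp: cube_def)
      then show ?thesis by (simp add: abs_le_iff)
    qed
    then show "?s \<le> lam * w (hub w v k) * w (hub w v' k) / lattice_norm (hub w v k - hub w v' k) powr \<alpha>"
      using w ne radius_pos[of k] by (intro link_rate found_hub) auto
  qed (use lam_pos finite_cube level_ge_1[of k] in auto)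
  also have "exp (- ?s) = cross_err k"
  proof -
    have 1: "level k * level k / radius k powr \<alpha> = radius k powr (2 * a - \<alpha>)"
      using radius_pos[of k]
      by (simp add: level_def powr_add[symmetric] powr_diff[symmetric])
    have 2: "(real CARD('d) * (3 * radius k)) powr \<alpha> = (3 * real CARD('d)) powr \<alpha> * radius k powr \<alpha>"
      using radius_pos[of k] by (simp add: powr_mult mult_ac)
    show ?thesis unfolding 2 rate_split 1 cross_err_def by simp
  qed
  also have "cross_err k * prob {\<omega> \<in> space M. ?P (Wt \<omega>)} \<le> cross_err k * ?q"
    by (intro mult_left_mono finite_measure_mono err_nonneg) auto
  finally have l: "prob {\<omega> \<in> space M. ?P (Wt \<omega>) \<and> \<not> crossed (config \<omega>) v v' k} \<le> cross_err k * ?q"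
    by (simp add: crossed_def)
  have "prob {\<omega> \<in> space M. heavy J T (Wt \<omega>) \<and> \<not> crossed (config \<omega>) v v' k} \<le>
      (hub_err k + hub_err k + cross_err k) * ?q"
    by (rule prob_split3[OF prob_not_found[OF J] prob_not_found[OF J] l]) auto
  also have "\<dots> \<le> err k * ?q"
    using err_nonneg[of k] err_nonneg(1)[of "Suc k"] by (intro prob_mono_factor) (simp add: err_def)
  finally show ?thesis .
qed

text \<open>For fixed \<open>k\<close> the rate tends to infinity with \<open>T\<close>: a heavy enough vertex is itself adjacent to its hub.\<close>

lemma prob_heavy_not_joined_hub:
  assumes J: "finite J" "card J \<le> 2" and v: "v \<in> J" and T: "0 \<le> T"
  shows "prob {\<omega> \<in> space M. heavy J T (Wt \<omega>) \<and> \<not> adj_or_eq (E \<omega>) v (hub (Wt \<omega>) v k)}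
    \<le> (err k + exp (- (lam * T * level k / (real CARD('d) * radius k) powr \<alpha>))) *
      prob {\<omega> \<in> space M. heavy J T (Wt \<omega>)}"
proof -
  let ?q = "prob {\<omega> \<in> space M. heavy J T (Wt \<omega>)}"
  let ?P = "\<lambda>w. heavy J T w \<and> found w v k \<and> found w v k"
  let ?s = "lam * T * level k / (real CARD('d) * radius k) powr \<alpha>"
  note [measurable] = pred_heavy[OF J(1)]
  have P: "Measurable.pred weight_space ?P" by measurable
  have "prob {\<omega> \<in> space M. ?P (Wt \<omega>) \<and> \<not> adj_or_eq (E \<omega>) v (hub (Wt \<omega>) v k)}
      \<le> exp (- ?s) * prob {\<omega> \<in> space M. ?P (Wt \<omega>)}"
  proof (rule random_edge_absent[OF P, where R = "insert v ((\<lambda>z. v + z) ` cube k)"])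
    fix w assume w: "?P w"
    have kk: "hub w v k - v \<in> cube k" using found_hub(2)[of w v k] w by auto
    then show "v \<in> insert v ((\<lambda>z. v + z) ` cube k) \<and> hub w v k \<in> insert v ((\<lambda>z. v + z) ` cube k)"
      by (auto dest: mem_translate_cube)
    assume ne: "v \<noteq> hub w v k"
    have near: "\<bar>real_of_int ((v - hub w v k) $ l)\<bar> \<le> radius k" for l
      using kk by (auto simp: cube_def abs_minus_commute)
    have h: "level k < w (hub w v k)" "T < w v" using found_hub(1)[of w v k] w v by (auto simp: heavy_def)
    have pos: "0 < level k" using level_ge_1[of k] by simp
    show "?s \<le> lam * w v * w (hub w v k) / lattice_norm (v - hub w v k) powr \<alpha>"
    proof (rule frac_le)
      show "lam * T * level k \<le> lam * w v * w (hub w v k)"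
        using h T pos lam_pos by (intro mult_mono) auto
      show "0 \<le> lam * w v * w (hub w v k)"
        using h T pos lam_pos by (intro mult_nonneg_nonneg) auto
      show "0 < lattice_norm (v - hub w v k) powr \<alpha>" using lattice_norm_pos[OF ne] by simp
      show "lattice_norm (v - hub w v k) powr \<alpha> \<le> (real CARD('d) * radius k) powr \<alpha>"
        using lattice_norm_le[OF near] alpha_pos lattice_norm_pos[OF ne] by (intro powr_mono2) auto
    qed
  qed (use lam_pos T finite_cube level_ge_1[of k] in auto)
  also have "exp (- ?s) * prob {\<omega> \<in> space M. ?P (Wt \<omega>)} \<le> exp (- ?s) * ?q"
    by (intro mult_left_mono finite_measure_mono) auto
  finally have l: "prob {\<omega> \<in> space M. ?P (Wt \<omega>) \<and> \<not> adj_or_eq (E \<omega>) v (hub (Wt \<omega>) v k)} \<le> exp (- ?s) * ?q" .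
  have "prob {\<omega> \<in> space M. heavy J T (Wt \<omega>) \<and> \<not> adj_or_eq (E \<omega>) v (hub (Wt \<omega>) v k)} \<le>
      (hub_err k + hub_err k + exp (- ?s)) * ?q"
    by (rule prob_split3[OF prob_not_found[OF J] prob_not_found[OF J] l]) measurable
  also have "\<dots> \<le> (err k + exp (- ?s)) * ?q"
    using err_nonneg[of k] err_nonneg(1)[of "Suc k"] by (intro prob_mono_factor) (simp add: err_def)
  finally show ?thesis .
qed

end

section \<open>Mass transport\<close>

lemma ex_translate: "(\<exists>w. P (w + a)) \<longleftrightarrow> (\<exists>w. P w)" for a :: "'g :: group_add"
proof
  assume "\<exists>w. P w"
  then obtain w where "P w" ..
  then have "P ((w - a) + a)" by simp
  then show "\<exists>w. P (w + a)" ..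
qed blast

lemma adjacency_translate:
  "(u, v) \<in> adjacency (snd (translate a x)) \<longleftrightarrow> (u + a, v + a) \<in> adjacency (snd x)"
  by (simp add: adjacency_def translate_def)

lemma relpow_translate:
  "(u, v) \<in> adjacency (snd (translate a x)) ^^ n \<longleftrightarrow> (u + a, v + a) \<in> adjacency (snd x) ^^ n"
proof (induction n arbitrary: v)
  case (Suc n)
  have "(\<exists>w. (u + a, w + a) \<in> adjacency (snd x) ^^ n \<and> (w + a, v + a) \<in> adjacency (snd x)) \<longleftrightarrow>
      (\<exists>w. (u + a, w) \<in> adjacency (snd x) ^^ n \<and> (w, v + a) \<in> adjacency (snd x))"
    by (rule ex_translate)
  then show ?case by (auto simp: relcomp_unfold Suc.IH adjacency_translate)
qed simp

lemma dist_le_translate: "dist_le (snd (translate a x)) n u v \<longleftrightarrow> dist_le (snd x) n (u + a) (v + a)"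
  by (simp add: dist_le_iff relpow_translate)

lemma joined_translate: "joined (snd (translate a x)) u v \<longleftrightarrow> joined (snd x) (u + a) (v + a)"
  by (simp add: joined_iff_dist_le dist_le_translate)

lemma image_translate_eq_iff: "(\<lambda>v. v + a) ` e = {u + a, v + a} \<longleftrightarrow> e = {u, v :: int ^ 'd}"
proof -
  have "(\<lambda>v. v + a) ` e = (\<lambda>v. v + a) ` {u, v} \<longleftrightarrow> e = {u, v}"
    by (rule inj_image_eq_iff) (auto intro: injI)
  then show ?thesis by simp
qed

lemma translate_delete:
  "translate a (w, G - {{u + a, v + a}}) = (fst (translate a (w, G)), snd (translate a (w, G)) - {{u, v}})"
  by (auto simp: translate_def image_translate_eq_iff)

lemma pred_successively:
  assumes "\<And>e. Measurable.pred N (\<lambda>x. e \<in> G x)"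
  shows "Measurable.pred N (\<lambda>x. successively (\<lambda>u v. {u, v} \<in> G x) p)"
proof (induction p rule: induct_list012)
  case (3 x y zs)
  then show ?case unfolding successively.simps by (intro pred_intros_logic assms)
qed auto

lemma pred_dist_le [measurable (raw)]:
  assumes [measurable]: "\<And>e. Measurable.pred N (\<lambda>x. e \<in> G x)"
  shows "Measurable.pred N (\<lambda>x. dist_le (G x) n u (v :: 'v :: countable))"
proof -
  note [measurable] = pred_successively[OF assms]
  show ?thesis unfolding dist_le_def occupied_path_def by measurable
qed

lemma pred_joined [measurable (raw)]:
  assumes "\<And>e. Measurable.pred N (\<lambda>x. e \<in> G x)"
  shows "Measurable.pred N (\<lambda>x. joined (G x) u (v :: 'v :: countable))"
  unfolding joined_iff_dist_le using assms by measurable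

text \<open>Countable quantifiers only, for measurability.\<close>

lemma infinite_iff_list: "infinite S \<longleftrightarrow> (\<forall>xs. \<exists>v. v \<notin> set xs \<and> v \<in> S)"
proof
  assume "infinite S"
  then have "\<not> S \<subseteq> set xs" for xs using finite_subset[of S "set xs"] by auto
  then show "\<forall>xs. \<exists>v. v \<notin> set xs \<and> v \<in> S" by auto
next
  assume "\<forall>xs. \<exists>v. v \<notin> set xs \<and> v \<in> S"
  then have "set xs \<noteq> S" for xs by auto
  then show "infinite S" using finite_list[of S] by auto
qed

lemma pred_infinite:
  assumes "\<And>v :: 'v :: countable. Measurable.pred N (\<lambda>x. P x v)"
  shows "Measurable.pred N (\<lambda>x. infinite {v. P x v})"
proof -
  note [measurable] = assms
  show ?thesis unfolding infinite_iff_list mem_Collect_eq by measurable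
qed

context scale_free_percolation
begin

text \<open>Read \<open>R x u y\<close> as \<open>u\<close> sending mass 1 to \<open>y\<close>. By translation invariance the expected mass received by the origin equals
  the expected mass sent by it, which is at most 1.\<close>

lemma mass_transport:
  assumes meas: "\<And>u y. Measurable.pred config_space (\<lambda>x. R x u y)"
    and equiv: "\<And>x a u y. R (translate a x) u y \<longleftrightarrow> R x (u + a) (y + a)"
    and unique: "\<And>x u y y'. R x u y \<Longrightarrow> R x u y' \<Longrightarrow> y = y'"
  shows "prob {\<omega> \<in> space M. infinite {u. R (config \<omega>) u 0}} = 0"
proof -
  let ?S = "{\<omega> \<in> space M. infinite {u. R (config \<omega>) u 0}}"
  have measM: "{\<omega> \<in> space M. R (config \<omega>) u y} \<in> events" for u y
    using measurable_compose[OF measurable_config_M meas[of u y]] by (simp add: pred_def)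
  have S: "?S \<in> events"
    using measurable_compose[OF measurable_config_M pred_infinite[OF meas]] by (simp add: pred_def)
  have "(\<integral>\<^sup>+\<omega>. \<infinity> * indicator ?S \<omega> \<partial>M) \<le>
      (\<integral>\<^sup>+\<omega>. \<integral>\<^sup>+u. indicator {\<omega> \<in> space M. R (config \<omega>) u 0} \<omega> \<partial>count_space UNIV \<partial>M)"
  proof (rule nn_integral_mono)
    fix \<omega> assume \<omega>: "\<omega> \<in> space M"
    have "(\<integral>\<^sup>+u. indicator {\<omega> \<in> space M. R (config \<omega>) u 0} \<omega> \<partial>count_space UNIV) =
        (\<integral>\<^sup>+u. indicator {u. R (config \<omega>) u 0} u \<partial>count_space UNIV)"
      using \<omega> by (intro nn_integral_cong) (auto simp: indicator_def)
    also have "\<dots> = emeasure (count_space UNIV) {u. R (config \<omega>) u 0}" by simp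
    finally have eq: "(\<integral>\<^sup>+u. indicator {\<omega> \<in> space M. R (config \<omega>) u 0} \<omega> \<partial>count_space UNIV) =
        emeasure (count_space UNIV) {u. R (config \<omega>) u 0}" .
    show "\<infinity> * indicator ?S \<omega> \<le>
        (\<integral>\<^sup>+u. indicator {\<omega> \<in> space M. R (config \<omega>) u 0} \<omega> \<partial>count_space UNIV)"
      unfolding eq by (cases "infinite {u. R (config \<omega>) u 0}") (simp_all add: indicator_def)
  qed
  also have "\<dots> = (\<integral>\<^sup>+u. \<integral>\<^sup>+\<omega>. indicator {\<omega> \<in> space M. R (config \<omega>) u 0} \<omega> \<partial>M \<partial>count_space UNIV)"
    using measM by (intro nn_integral_count_space_nn_integral) auto
  also have "\<dots> = (\<integral>\<^sup>+u. \<integral>\<^sup>+\<omega>. indicator {\<omega> \<in> space M. R (config \<omega>) 0 (- u)} \<omega> \<partial>M \<partial>count_space UNIV)"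
  proof (rule nn_integral_cong)
    fix u :: "int ^ 'd"
    have "prob {\<omega> \<in> space M. R (config \<omega>) u 0} = prob {\<omega> \<in> space M. R (translate (- u) (config \<omega>)) u 0}"
      by (rule prob_translate[symmetric]) (rule meas)
    also have "\<dots> = prob {\<omega> \<in> space M. R (config \<omega>) 0 (- u)}" by (simp add: equiv)
    finally show "(\<integral>\<^sup>+\<omega>. indicator {\<omega> \<in> space M. R (config \<omega>) u 0} \<omega> \<partial>M) =
        (\<integral>\<^sup>+\<omega>. indicator {\<omega> \<in> space M. R (config \<omega>) 0 (- u)} \<omega> \<partial>M)"
      using measM by (simp add: emeasure_eq_measure)
  qed
  also have "\<dots> = (\<integral>\<^sup>+\<omega>. \<integral>\<^sup>+u. indicator {\<omega> \<in> space M. R (config \<omega>) 0 (- u)} \<omega> \<partial>count_space UNIV \<partial>M)"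
    using measM by (intro nn_integral_count_space_nn_integral[symmetric]) auto
  also have "\<dots> \<le> (\<integral>\<^sup>+\<omega>. 1 \<partial>M)"
  proof (rule nn_integral_mono)
    fix \<omega> assume \<omega>: "\<omega> \<in> space M"
    let ?U = "{u. R (config \<omega>) 0 (- u)}"
    have "(\<integral>\<^sup>+u. indicator {\<omega> \<in> space M. R (config \<omega>) 0 (- u)} \<omega> \<partial>count_space UNIV) =
        (\<integral>\<^sup>+u. indicator ?U u \<partial>count_space UNIV)"
      using \<omega> by (intro nn_integral_cong) (auto simp: indicator_def)
    also have "\<dots> = emeasure (count_space UNIV) ?U" by simp
    also have "\<dots> \<le> 1"
    proof (cases "?U = {}")
      case True then show ?thesis by (simp only: emeasure_empty zero_le)
    next
      case False
      then obtain u where u: "u \<in> ?U" by blast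
      have "v = u" if "v \<in> ?U" for v
        using unique[of "config \<omega>" 0 "- v" "- u"] u that by simp
      then have "?U = {u}" using u by blast
      then show ?thesis by simp
    qed
    finally show "(\<integral>\<^sup>+u. indicator {\<omega> \<in> space M. R (config \<omega>) 0 (- u)} \<omega> \<partial>count_space UNIV) \<le> 1" .
  qed
  finally have "\<infinity> * emeasure M ?S \<le> 1"
    using S emeasure_space_1 by (simp add: nn_integral_cmult)
  then have "emeasure M ?S = 0"
    by (cases "emeasure M ?S = 0") (auto simp: ennreal_top_mult top_unique)
  then show ?thesis by (simp add: measure_def)
qed

end

context hub_percolation
begin

section \<open>Infinite clusters meet the core\<close>

text \<open>The core consists of the hubs, around any centre, from which the whole chain of higher hubs is
  present. The threshold \<open>T\<close> forces all vertices of these chains to have weight above \<open>T\<close>.\<close>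

definition in_core :: "real \<Rightarrow> ((int ^ 'd) \<Rightarrow> real) \<times> (int ^ 'd) set set \<Rightarrow> int ^ 'd \<Rightarrow> bool" where
  "in_core T x v \<longleftrightarrow> (\<exists>s k. hub (fst x) s k = v \<and> T \<le> level k \<and> (\<forall>j. k \<le> j \<longrightarrow> found (fst x) s j \<and> linked x s j))"

abbreviation core :: "real \<Rightarrow> ((int ^ 'd) \<Rightarrow> real) \<times> (int ^ 'd) set set \<Rightarrow> (int ^ 'd) set" where
  "core T x \<equiv> {v. in_core T x v}"

lemma pred_in_core [measurable]: "Measurable.pred config_space (\<lambda>x. in_core T x v)"
  unfolding in_core_def by measurable

lemma level_mono: "i \<le> j \<Longrightarrow> level i \<le> level j"
  unfolding level_def using radius_mono radius_pos a_pos by (intro powr_mono2) (auto simp: less_imp_le)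

lemma in_core_heavy:
  assumes "in_core T x v" shows "T < fst x v"
proof -
  from assms obtain s k where "hub (fst x) s k = v" "T \<le> level k" "found (fst x) s k"
    by (auto simp: in_core_def)
  then show ?thesis using found_hub(1)[of "fst x" s k] by simp
qed

lemma in_core_antimono: "T \<le> T' \<Longrightarrow> in_core T' x v \<Longrightarrow> in_core T x v"
  unfolding in_core_def by fastforce

text \<open>No chain used by the core visits \<open>u\<close>, so none uses the edge \<open>e\<close>.\<close>

lemma in_core_delete:
  assumes u: "u \<in> e" "w u \<le> T"
  shows "in_core T (w, G - {e}) v \<longleftrightarrow> in_core T (w, G) v"
proof -
  have lk: "linked (w, G - {e}) s j \<longleftrightarrow> linked (w, G) s j"
    if "T \<le> level k" "k \<le> j" "found w s j" "found w s (Suc j)" for s k j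
  proof -
    have "T < w (hub w s j)" "T < w (hub w s (Suc j))"
      using that found_hub(1)[of w s j] found_hub(1)[of w s "Suc j"] level_mono[of k j] level_mono[of k "Suc j"]
      by auto
    then have "{hub w s j, hub w s (Suc j)} \<noteq> e" using u by auto
    then show ?thesis by (auto simp: linked_def adj_or_eq_def)
  qed
  have eq: "(\<forall>j. k \<le> j \<longrightarrow> found w s j \<and> linked (w, G - {e}) s j) \<longleftrightarrow>
      (\<forall>j. k \<le> j \<longrightarrow> found w s j \<and> linked (w, G) s j)" if T: "T \<le> level k" for s k
  proof (cases "\<forall>j. k \<le> j \<longrightarrow> found w s j")
    case True
    then have "linked (w, G - {e}) s j \<longleftrightarrow> linked (w, G) s j" if "k \<le> j" for j
      using lk[OF T that, of s] that by simp
    then show ?thesis by auto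
  next
    case False then show ?thesis by auto
  qed
  show ?thesis unfolding in_core_def fst_conv by (intro ex_cong1 conj_cong refl eq)
qed

lemma hub_translate: "hub (fst (translate z x)) s k + z = hub (fst x) (s + z) k"
  by (simp add: hub_def translate_def add_ac)

lemma found_translate: "found (fst (translate z x)) s k \<longleftrightarrow> found (fst x) (s + z) k"
  by (simp add: found_def translate_def add_ac)

lemma linked_translate: "linked (translate z x) s k \<longleftrightarrow> linked x (s + z) k"
  unfolding linked_def adj_or_eq_def hub_translate[symmetric] by (simp add: translate_def)

lemma in_core_translate: "in_core T (translate z x) v \<longleftrightarrow> in_core T x (v + z)"
proof -
  have "in_core T (translate z x) v \<longleftrightarrow> (\<exists>s k. hub (fst x) (s + z) k = v + z \<and> T \<le> level k \<and>
      (\<forall>j. k \<le> j \<longrightarrow> found (fst x) (s + z) j \<and> linked x (s + z) j))"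
    unfolding in_core_def found_translate linked_translate hub_translate[symmetric] by simp
  also have "\<dots> \<longleftrightarrow> in_core T x (v + z)"
    unfolding in_core_def by (rule ex_translate)
  finally show ?thesis .
qed

lemma heavy_empty [simp]: "heavy {} T w" by (simp add: heavy_def)

lemma AE_eventually_linked:
  "AE \<omega> in M. eventually (\<lambda>k. found (Wt \<omega>) s k \<and> linked (config \<omega>) s k) sequentially"
proof -
  have bound: "prob {\<omega> \<in> space M. \<not> (found (Wt \<omega>) s k \<and> linked (config \<omega>) s k)} \<le> 2 * err k" for k
  proof -
    have "prob {\<omega> \<in> space M. \<not> (found (Wt \<omega>) s k \<and> linked (config \<omega>) s k)} \<le>
        prob ({\<omega> \<in> space M. \<not> found (Wt \<omega>) s k} \<union> {\<omega> \<in> space M. \<not> linked (config \<omega>) s k})"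
      by (intro finite_measure_mono) auto
    also have "\<dots> \<le> prob {\<omega> \<in> space M. \<not> found (Wt \<omega>) s k} + prob {\<omega> \<in> space M. \<not> linked (config \<omega>) s k}"
      by (intro measure_Un_le) auto
    also have "\<dots> \<le> hub_err k + err k"
      using prob_not_found[of "{}" 0 s k] prob_not_linked[of "{}" 0 s k] by (simp add: prob_space)
    also have "\<dots> \<le> 2 * err k" using err_nonneg[of k] err_nonneg[of "Suc k"] by (simp add: err_def)
    finally show ?thesis .
  qed
  have "AE \<omega> in M. eventually (\<lambda>k. \<omega> \<in> space M - {\<omega> \<in> space M. \<not> (found (Wt \<omega>) s k \<and> linked (config \<omega>) s k)}) sequentially"
  proof (rule borel_cantelli_AE1)
    show "summable (\<lambda>k. prob {\<omega> \<in> space M. \<not> (found (Wt \<omega>) s k \<and> linked (config \<omega>) s k)})"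
      by (rule summable_comparison_test'[OF summable_mult[OF summable_err, of 2]]) (use bound in auto)
  qed (auto simp: emeasure_eq_measure)
  then show ?thesis by eventually_elim (auto elim: eventually_mono)
qed

lemma eventually_radius_ge: "eventually (\<lambda>k. r \<le> radius k) sequentially"
  using radius_at_top by (simp add: filterlim_at_top)

lemma AE_eventually_crossed:
  "AE \<omega> in M. eventually (\<lambda>k. crossed (config \<omega>) s s' k) sequentially"
proof -
  have "AE \<omega> in M. eventually (\<lambda>k. \<omega> \<in> space M - {\<omega> \<in> space M. \<not> crossed (config \<omega>) s s' k}) sequentially"
  proof (rule borel_cantelli_AE1)
    show "summable (\<lambda>k. prob {\<omega> \<in> space M. \<not> crossed (config \<omega>) s s' k})"
    proof (rule summable_comparison_test_ev[OF _ summable_err])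
      show "eventually (\<lambda>k. norm (prob {\<omega> \<in> space M. \<not> crossed (config \<omega>) s s' k}) \<le> err k) sequentially"
        using eventually_radius_ge[of "lattice_norm (s - s')"]
      proof eventually_elim
        case (elim k)
        then show ?case using prob_not_crossed[of "{}" s s' k 0] by (simp add: prob_space)
      qed
    qed
  qed (auto simp: emeasure_eq_measure)
  then show ?thesis by eventually_elim (auto elim: eventually_mono)
qed

lemma eventually_level_ge: "eventually (\<lambda>k. r \<le> level k) sequentially"
  using eventually_radius_ge[of "max 1 r powr (1 / a)"]
proof eventually_elim
  case (elim k)
  have "(max 1 r powr (1 / a)) powr a \<le> radius k powr a"
    using elim a_pos by (intro powr_mono2) auto
  then show ?case using a_pos by (simp add: level_def powr_powr)
qed

lemma AE_core_nonempty: "AE \<omega> in M. core T (config \<omega>) \<noteq> {}"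
  using AE_eventually_linked[of 0]
proof eventually_elim
  case (elim \<omega>)
  have "eventually (\<lambda>k. T \<le> level k) sequentially" by (rule eventually_level_ge)
  then have "eventually (\<lambda>k. T \<le> level k \<and> found (Wt \<omega>) 0 k \<and> linked (config \<omega>) 0 k) sequentially"
    using elim by eventually_elim auto
  then obtain k where "\<And>j. k \<le> j \<Longrightarrow> T \<le> level j \<and> found (Wt \<omega>) 0 j \<and> linked (config \<omega>) 0 j"
    by (auto simp: eventually_sequentially)
  then have "in_core T (config \<omega>) (hub (Wt \<omega>) 0 k)" unfolding in_core_def by fastforce
  then show ?case by blast
qed

text \<open>A vertex of weight 0 has connection probability 0 to every other vertex.\<close>

lemma AE_weight_pos_if_edge: "AE \<omega> in M. \<forall>x. {0, x} \<in> E \<omega> \<longrightarrow> 0 < W 0 \<omega>"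
proof -
  have "AE \<omega> in M. {0, x} \<in> E \<omega> \<longrightarrow> 0 < W 0 \<omega>" for x
  proof (cases "x = 0")
    case True
    then have "{0, x} \<notin> lattice_edges" by (auto simp: lattice_edges_def)
    then show ?thesis using not_lattice_edge by auto
  next
    case False
    let ?e = "{0, x}" and ?A = "{w :: (int ^ 'd) \<Rightarrow> real. w 0 = 0}"
    have e: "{?e} \<subseteq> lattice_edges" using False by (auto simp: lattice_edges_def)
    have A: "?A \<in> sets weight_space"
    proof -
      have "Measurable.pred weight_space (\<lambda>w :: (int ^ 'd) \<Rightarrow> real. w 0 = 0)" by measurable
      then show ?thesis by (simp add: pred_def)
    qed
    have "prob {\<omega> \<in> space M. W 0 \<omega> = 0 \<and> ?e \<in> E \<omega>} =
        (\<integral>\<omega>. indicator {\<omega> \<in> space M. W 0 \<omega> = 0 \<and> ?e \<in> E \<omega>} \<omega> \<partial>M)"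
      by simp
    also have "\<dots> = (\<integral>\<omega>. indicator ?A (Wt \<omega>) * indicator {\<omega> \<in> space M. {?e} \<subseteq> E \<omega>} \<omega> \<partial>M)"
      by (intro Bochner_Integration.integral_cong) (auto simp: indicator_def)
    also have "\<dots> = (\<integral>\<omega>. indicator ?A (Wt \<omega>) * (\<Prod>e\<in>{?e}. edge_prob (Wt \<omega>) e) \<partial>M)"
      using A by (intro integral_edges[OF _ e, where B = 1]) (auto simp: indicator_def)
    also have "\<dots> = (\<integral>\<omega>. 0 \<partial>M)"
      using False by (intro Bochner_Integration.integral_cong) (auto simp: indicator_def edge_prob_eq)
    finally have "prob {\<omega> \<in> space M. W 0 \<omega> = 0 \<and> ?e \<in> E \<omega>} = 0" by simp
    then have "AE \<omega> in M. \<not> (W 0 \<omega> = 0 \<and> ?e \<in> E \<omega>)"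
      by (subst AE_iff_measurable[OF _ refl]) (auto simp: emeasure_eq_measure)
    with AE_weights_nonneg show ?thesis
      by eventually_elim (auto simp: less_le)
  qed
  then show ?thesis unfolding AE_all_countable by blast
qed

lemma infinite_cluster_edge:
  assumes "infinite (cluster G u)" obtains v where "{u, v} \<in> G"
proof -
  have "\<not> cluster G u \<subseteq> {u}" using assms finite_subset by blast
  then obtain v where "(u, v) \<in> (adjacency G)\<^sup>*" "v \<noteq> u" by (auto simp: cluster_def joined_iff)
  then obtain z where "(u, z) \<in> adjacency G" by (metis converse_rtranclE)
  then show ?thesis using that by (auto simp: adjacency_def)
qed

text \<open>The situation to be excluded: the origin lies in an infinite cluster that misses the core. The weight
  bound makes the edge from 0 to \<open>b\<close> irrelevant for the core, and \<open>b\<close> is a place where the cluster could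
  be attached to it.\<close>

definition attachable :: "real \<Rightarrow> int ^ 'd \<Rightarrow> ((int ^ 'd) \<Rightarrow> real) \<times> (int ^ 'd) set set \<Rightarrow> bool" where
  "attachable T b x \<longleftrightarrow> infinite (cluster (snd x) 0) \<and> cluster (snd x) 0 \<inter> core T x = {} \<and>
     fst x 0 \<le> T \<and> in_core T x b"

lemma pred_infinite_cluster [measurable (raw)]:
  assumes "\<And>e. Measurable.pred N (\<lambda>x. e \<in> G x)"
  shows "Measurable.pred N (\<lambda>x. infinite (cluster (G x) (u :: 'v :: countable)))"
  unfolding cluster_def by (intro pred_infinite pred_joined assms)

lemma pred_attachable [measurable]: "Measurable.pred config_space (attachable T b)"
proof -
  have "cluster (snd x) 0 \<inter> core T x = {} \<longleftrightarrow> (\<forall>v. \<not> (joined (snd x) 0 v \<and> in_core T x v))" for x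
    by (auto simp: cluster_def)
  then show ?thesis unfolding attachable_def[abs_def] by simp
qed

text \<open>The mass transport: every vertex of a hanging piece sends its mass to the port of that piece.\<close>

definition hangs :: "real \<Rightarrow> int ^ 'd \<Rightarrow> ((int ^ 'd) \<Rightarrow> real) \<times> (int ^ 'd) set set \<Rightarrow> int ^ 'd \<Rightarrow> int ^ 'd \<Rightarrow> bool" where
  "hangs T b x u y \<longleftrightarrow> port (snd x) (core T x) {v. fst x v \<le> T} b y \<and>
     u \<in> cluster (snd x - {{y, y + b}}) y"

lemma hangs_iff: "hangs T b x u y \<longleftrightarrow> fst x y \<le> T \<and> {y, y + b} \<in> snd x \<and> in_core T x (y + b) \<and>
  (\<forall>v. \<not> (joined (snd x - {{y, y + b}}) y v \<and> in_core T x v)) \<and> joined (snd x - {{y, y + b}}) y u"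
  by (auto simp: hangs_def port_def cluster_def)

lemma pred_hangs: "Measurable.pred config_space (\<lambda>x. hangs T b x u y)"
  unfolding hangs_iff by measurable

lemma hangs_unique: "hangs T b x u y \<Longrightarrow> hangs T b x u y' \<Longrightarrow> y = y'"
  unfolding hangs_def
  by (rule port_unique[where K = "core T x" and L = "{v. fst x v \<le> T}"]) (auto dest: in_core_heavy)

lemma hangs_translate: "hangs T b (translate z x) u y \<longleftrightarrow> hangs T b x (u + z) (y + z)"
proof -
  obtain w G where x: "x = (w, G)" by (cases x)
  let ?G = "G - {{y + z, y + z + b}}"
  have yb: "(y + b) + z = y + z + b" by (simp add: add_ac)
  have *: "joined (snd (translate z x) - {{y, y + b}}) y v \<longleftrightarrow> joined ?G (y + z) (v + z)" for v
  proof -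
    have "joined (snd (translate z (w, G - {{y + z, (y + b) + z}}))) y v \<longleftrightarrow>
        joined (G - {{y + z, (y + b) + z}}) (y + z) (v + z)"
      by (simp only: joined_translate snd_conv)
    then show ?thesis
      unfolding translate_delete[of z w G y "y + b"] unfolding yb x snd_conv .
  qed
  have ex: "(\<exists>v. joined ?G (y + z) (v + z) \<and> in_core T x (v + z)) \<longleftrightarrow>
      (\<exists>v. joined ?G (y + z) v \<and> in_core T x v)"
    by (rule ex_translate[where P = "\<lambda>v. joined ?G (y + z) v \<and> in_core T x v"])
  have "hangs T b (translate z x) u y \<longleftrightarrow> w (y + z) \<le> T \<and> {y + z, y + b + z} \<in> G \<and>
      in_core T x (y + b + z) \<and> \<not> (\<exists>v. joined ?G (y + z) (v + z) \<and> in_core T x (v + z)) \<and>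
      joined ?G (y + z) (u + z)"
    unfolding hangs_iff * in_core_translate by (simp add: translate_def x)
  also have "\<dots> \<longleftrightarrow> hangs T b x (u + z) (y + z)"
    unfolding hangs_iff yb ex by (simp add: x)
  finally show ?thesis .
qed

text \<open>Otherwise the edge from 0 to \<open>b\<close>, which is absent, would with positive probability be present while everything else
  is unchanged. Then 0 would be a port with an infinite piece below it and would receive infinite mass.\<close>

lemma AE_not_attachable:
  assumes T: "0 \<le> T" shows "AE \<omega> in M. \<not> attachable T b (config \<omega>)"
proof (rule ccontr)
  let ?e = "{0, b}"
  let ?del = "\<lambda>\<omega>. (Wt \<omega>, E \<omega> - {?e})"
  let ?D = "{\<omega> \<in> space M. attachable T b (?del \<omega>)}"
  assume contra: "\<not> (AE \<omega> in M. \<not> attachable T b (config \<omega>))"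
  have b: "b \<noteq> 0" if "attachable T b x" for x
  proof -
    have "0 \<in> cluster (snd x) 0" by (simp add: cluster_def)
    then have "0 \<notin> core T x" using that unfolding attachable_def by blast
    then show ?thesis using that by (auto simp: attachable_def)
  qed
  have "b \<noteq> 0"
  proof
    assume "b = 0"
    then have "\<not> attachable T b x" for x using b[of x] by blast
    then show False using contra by simp
  qed
  then have e: "?e \<in> lattice_edges" by (auto simp: lattice_edges_def)
  have [measurable]: "?del \<in> M \<rightarrow>\<^sub>M config_space" by (intro measurable_config) auto
  have D: "?D \<in> events"
    using measurable_compose[of ?del M config_space "attachable T b"] by (simp add: pred_def)
  have same: "attachable T b (?del \<omega>)" if "attachable T b (config \<omega>)" for \<omega>
  proof -
    have "?e \<notin> E \<omega>"
    proof
      assume "?e \<in> E \<omega>"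
      then have "joined (E \<omega>) 0 b" by (rule joined_edge)
      then show False using that by (auto simp: attachable_def cluster_def)
    qed
    then show ?thesis using that by (simp add: config_def)
  qed
  have Wpos: "AE \<omega> in M. attachable T b (?del \<omega>) \<longrightarrow> 0 < edge_prob (Wt \<omega>) ?e"
    using AE_weight_pos_if_edge
  proof eventually_elim
    case (elim \<omega>)
    show ?case
    proof
      assume att: "attachable T b (?del \<omega>)"
      then have inf: "infinite (cluster (E \<omega> - {?e}) 0)" by (simp add: attachable_def)
      obtain v where "{0, v} \<in> E \<omega> - {?e}" by (rule infinite_cluster_edge[OF inf])
      then have "0 < W 0 \<omega>" using elim by auto
      moreover have "0 < W b \<omega>" using att T in_core_heavy[of T "?del \<omega>" b] by (auto simp: attachable_def)
      moreover have "0 < lattice_norm (0 - b) powr \<alpha>" using lattice_norm_pos[of 0 b] \<open>b \<noteq> 0\<close> by simp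
      ultimately show "0 < edge_prob (Wt \<omega>) ?e" using lam_pos \<open>b \<noteq> 0\<close> by (simp add: edge_prob_eq)
    qed
  qed
  have "hangs T b (config \<omega>) u 0"
    if "attachable T b (?del \<omega>)" "?e \<in> E \<omega>" "u \<in> cluster (E \<omega> - {?e}) 0" for \<omega> u
  proof -
    have W0: "W 0 \<omega> \<le> T" using that by (simp add: attachable_def)
    then have "in_core T (config \<omega>) v \<longleftrightarrow> in_core T (?del \<omega>) v" for v
      using in_core_delete[of 0 ?e "Wt \<omega>" T "E \<omega>" v] by (simp add: config_def)
    then show ?thesis using that W0 by (auto simp: hangs_iff attachable_def cluster_def)
  qed
  then have "{u. hangs T b (config \<omega>) u 0} \<supseteq> cluster (E \<omega> - {?e}) 0"
    if "attachable T b (?del \<omega>)" "?e \<in> E \<omega>" for \<omega> using that by blast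
  then have sub: "{\<omega> \<in> space M. attachable T b (?del \<omega>) \<and> ?e \<in> E \<omega>} \<subseteq>
      {\<omega> \<in> space M. infinite {u. hangs T b (config \<omega>) u 0}}"
    by (auto simp: attachable_def dest: finite_subset)
  have "prob {\<omega> \<in> space M. infinite {u. hangs T b (config \<omega>) u 0}} = 0"
    by (rule mass_transport[where R = "hangs T b"]) (rule pred_hangs hangs_translate hangs_unique; assumption)+
  moreover have "prob {\<omega> \<in> space M. attachable T b (?del \<omega>) \<and> ?e \<in> E \<omega>} \<le>
      prob {\<omega> \<in> space M. infinite {u. hangs T b (config \<omega>) u 0}}"
    using measurable_compose[OF measurable_config_M pred_infinite[OF pred_hangs]]
    by (intro finite_measure_mono sub) (simp add: pred_def)
  ultimately have "emeasure M {\<omega> \<in> space M. attachable T b (?del \<omega>) \<and> ?e \<in> E \<omega>} = 0"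
    using measure_nonneg[of M "{\<omega> \<in> space M. attachable T b (?del \<omega>) \<and> ?e \<in> E \<omega>}"]
    by (simp add: emeasure_eq_measure)
  then have "(\<integral>\<^sup>+\<omega>. ennreal (edge_prob (Wt \<omega>) ?e) * indicator ?D \<omega> \<partial>M) = 0"
    using emeasure_edge_insertion[OF e _ pred_attachable] lam_pos by simp
  then have "AE \<omega> in M. ennreal (edge_prob (Wt \<omega>) ?e) * indicator ?D \<omega> = 0"
    using D measurable_compose[OF measurable_W_space measurable_edge_prob]
    by (subst (asm) nn_integral_0_iff_AE) auto
  then have "AE \<omega> in M. \<not> attachable T b (config \<omega>)"
    using Wpos AE_space
  proof eventually_elim
    case (elim \<omega>)
    show ?case
    proof
      assume "attachable T b (config \<omega>)"
      then have "attachable T b (?del \<omega>)" by (rule same)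
      then show False using elim by (auto simp: indicator_def)
    qed
  qed
  with contra show False by contradiction
qed

text \<open>Apply the previous lemma at a threshold \<open>n\<close> above the weight of the origin: the core only shrinks as the threshold
  grows, and it is almost surely not empty.\<close>

lemma AE_infinite_meets_core:
  "AE \<omega> in M. infinite (cluster (E \<omega>) 0) \<longrightarrow> cluster (E \<omega>) 0 \<inter> core 0 (config \<omega>) \<noteq> {}"
proof -
  have "AE \<omega> in M. \<forall>n b. \<not> attachable (real n) b (config \<omega>)"
    using AE_not_attachable by (simp add: AE_all_countable)
  moreover have "AE \<omega> in M. \<forall>n::nat. core (real n) (config \<omega>) \<noteq> {}"
    using AE_core_nonempty by (simp add: AE_all_countable)
  ultimately show ?thesis
  proof eventually_elim
    case (elim \<omega>)
    obtain n :: nat where n: "W 0 \<omega> \<le> real n" using real_arch_simple by blast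
    obtain b where "in_core (real n) (config \<omega>) b" using elim(2) by blast
    then have "\<not> (infinite (cluster (E \<omega>) 0) \<and> cluster (E \<omega>) 0 \<inter> core (real n) (config \<omega>) = {})"
      using elim(1) n by (auto simp: attachable_def)
    moreover have "core (real n) (config \<omega>) \<subseteq> core 0 (config \<omega>)"
      using in_core_antimono[of 0 "real n" "config \<omega>"] by auto
    ultimately show ?case by blast
  qed
qed

text \<open>The chain reached in the core belongs to some centre \<open>s\<close>; its hubs are eventually adjacent to the hubs around the
  origin.\<close>

lemma AE_infinite_joined_hubs:
  "AE \<omega> in M. infinite (cluster (E \<omega>) 0) \<longrightarrow>
    eventually (\<lambda>k. joined (E \<omega>) 0 (hub (Wt \<omega>) 0 k)) sequentially"
proof -
  have "AE \<omega> in M. \<forall>s. eventually (\<lambda>k. crossed (config \<omega>) s 0 k) sequentially"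
    using AE_eventually_crossed by (simp add: AE_all_countable)
  with AE_infinite_meets_core show ?thesis
  proof eventually_elim
    case (elim \<omega>)
    show ?case
    proof
      assume "infinite (cluster (E \<omega>) 0)"
      then obtain v where v: "joined (E \<omega>) 0 v" "in_core 0 (config \<omega>) v"
        using elim(1) by (auto simp: cluster_def)
      then obtain s k where sk: "hub (Wt \<omega>) s k = v" "\<And>j. k \<le> j \<Longrightarrow> linked (config \<omega>) s j"
        by (auto simp: in_core_def)
      have j: "joined (E \<omega>) 0 (hub (Wt \<omega>) s j)" if "k \<le> j" for j
      proof -
        have "dist_le (E \<omega>) (j - k) (hub (Wt \<omega>) s k) (hub (Wt \<omega>) s j)"
          by (rule chain_dist_le) (use sk(2) that in \<open>auto simp: linked_def\<close>)
        then have "joined (E \<omega>) v (hub (Wt \<omega>) s j)" using sk(1) by (auto simp: joined_iff_dist_le)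
        then show ?thesis by (rule joined_trans[OF v(1)])
      qed
      have "eventually (\<lambda>j. crossed (config \<omega>) s 0 j) sequentially" using elim(2) by blast
      then show "eventually (\<lambda>j. joined (E \<omega>) 0 (hub (Wt \<omega>) 0 j)) sequentially"
        using eventually_ge_at_top[of k]
      proof eventually_elim
        case (elim i)
        then have "joined (E \<omega>) (hub (Wt \<omega>) s i) (hub (Wt \<omega>) 0 i)"
          by (auto simp: crossed_def dest: adj_or_eq_joined)
        then show ?case by (rule joined_trans[OF j[OF elim(2)]])
      qed
    qed
  qed
qed

end

section \<open>Joining two vertices through their hubs\<close>

lemma infinite_cluster_translate:
  "infinite (cluster (snd (translate a x)) u) \<longleftrightarrow> infinite (cluster (snd x) (u + a))"
proof -
  have "(\<lambda>v. v + a) ` cluster (snd (translate a x)) u = cluster (snd x) (u + a)"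
  proof (intro equalityI subsetI)
    fix v assume "v \<in> cluster (snd x) (u + a)"
    then have "v - a \<in> cluster (snd (translate a x)) u" by (simp add: cluster_def joined_translate)
    then show "v \<in> (\<lambda>v. v + a) ` cluster (snd (translate a x)) u"
      by (intro image_eqI[of _ _ "v - a"]) auto
  qed (auto simp: cluster_def joined_translate)
  moreover have "finite ((\<lambda>v. v + a) ` cluster (snd (translate a x)) u) \<longleftrightarrow> finite (cluster (snd (translate a x)) u)"
    by (rule finite_image_iff) (auto intro: inj_onI)
  ultimately show ?thesis by simp
qed

lemma (in finite_measure) measure_le_sum_list:
  assumes "set Ss \<subseteq> sets M" "S \<subseteq> \<Union> (set Ss)"
  shows "measure M S \<le> sum_list (map (measure M) Ss)"
proof -
  have Un: "measure M (\<Union> (set Ss)) \<le> sum_list (map (measure M) Ss)" if "set Ss \<subseteq> sets M" for Ss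
    using that
  proof (induction Ss)
    case (Cons A Ss)
    have "measure M (\<Union> (set (A # Ss))) \<le> measure M A + measure M (\<Union> (set Ss))"
      using Cons.prems by (simp add: measure_Un_le sets.finite_Union)
    then show ?case using Cons by simp
  qed simp
  have "measure M S \<le> measure M (\<Union> (set Ss))"
    using assms by (intro finite_measure_mono sets.finite_Union) auto
  also have "\<dots> \<le> sum_list (map (measure M) Ss)" by (rule Un) (rule assms)
  finally show ?thesis .
qed

context hub_percolation
begin

definition near :: "nat \<Rightarrow> nat \<Rightarrow> int ^ 'd \<Rightarrow> ((int ^ 'd) \<Rightarrow> real) \<times> (int ^ 'd) set set \<Rightarrow> bool" where
  "near k n v x \<longleftrightarrow> dist_le (snd x) n v (hub (fst x) v k)"

lemma near_iff: "near k n v x \<longleftrightarrow> (\<exists>h. hub (fst x) v k = h \<and> dist_le (snd x) n v h)"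
  by (simp add: near_def)

lemma pred_near [measurable]: "Measurable.pred config_space (near k n v)"
  unfolding near_iff[abs_def] by measurable

lemma pred_joined_hub [measurable]: "Measurable.pred config_space (\<lambda>x. joined (snd x) v (hub (fst x) v k))"
proof -
  have "joined (snd x) v (hub (fst x) v k) \<longleftrightarrow> (\<exists>h. hub (fst x) v k = h \<and> joined (snd x) v h)" for x
    by simp
  then show ?thesis by (simp del: simp_thms)
qed

text \<open>A finite cluster is bounded, so the events decrease to the empty set.\<close>

lemma tendsto_prob_finite_cluster_far:
  "(\<lambda>n. prob {\<omega> \<in> space M. finite (cluster (E \<omega>) 0) \<and> (\<exists>y. joined (E \<omega>) 0 y \<and> real n \<le> lattice_norm y)})
    \<longlonglongrightarrow> 0"
proof -
  let ?A = "\<lambda>n. {\<omega> \<in> space M. finite (cluster (E \<omega>) 0) \<and> (\<exists>y. joined (E \<omega>) 0 y \<and> real n \<le> lattice_norm y)}"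
  have fin[measurable]: "Measurable.pred M (\<lambda>\<omega>. finite (cluster (E \<omega>) 0))"
  proof -
    have "Measurable.pred M (\<lambda>\<omega>. \<not> infinite (cluster (E \<omega>) 0))" by measurable
    then show ?thesis by simp
  qed
  have "(\<lambda>n. prob (?A n)) \<longlonglongrightarrow> prob (\<Inter>n. ?A n)"
  proof (rule finite_Lim_measure_decseq)
    show "decseq ?A" by (auto simp: decseq_def intro: order_trans[OF of_nat_mono])
  qed auto
  moreover have "(\<Inter>n. ?A n) = {}"
  proof (rule equals0I)
    fix \<omega> assume \<omega>: "\<omega> \<in> (\<Inter>n. ?A n)"
    let ?S = "lattice_norm ` cluster (E \<omega>) 0"
    have "finite ?S" using \<omega> by auto
    obtain n :: nat where n: "Max ?S < real n" using reals_Archimedean2 by blast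
    obtain y where "y \<in> cluster (E \<omega>) 0" "real n \<le> lattice_norm y"
      using \<omega> by (auto simp: cluster_def)
    then have "real n \<le> Max ?S" using \<open>finite ?S\<close> by (meson Max_ge image_eqI order_trans)
    then show False using n by simp
  qed
  ultimately show ?thesis by simp
qed

text \<open>First \<open>k0\<close> is chosen so that the connection to all hubs of scale \<open>k \<ge> k0\<close> fails with small probability, then \<open>n\<close>
  bounds the length of this connection; \<open>n\<close> depends on \<open>k\<close> but, by translation invariance, not on the centre.\<close>

lemma hub_near_if_infinite:
  assumes "0 < \<epsilon>"
  shows "\<exists>k0. \<forall>k\<ge>k0. \<exists>n. prob {\<omega> \<in> space M. infinite (cluster (E \<omega>) 0) \<and> \<not> near k n 0 (config \<omega>)} < \<epsilon>"
proof -
  let ?h = "\<lambda>k \<omega>. hub (Wt \<omega>) 0 k"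
  have jm[measurable]: "Measurable.pred M (\<lambda>\<omega>. joined (E \<omega>) 0 (?h k \<omega>))" for k
    using pred_config_compose[OF pred_joined_hub[of 0 k]] by simp
  have nm[measurable]: "Measurable.pred M (\<lambda>\<omega>. near k n 0 (config \<omega>))" for k n
    by (rule pred_config_compose[OF pred_near])
  let ?D = "\<lambda>k. {\<omega> \<in> space M. infinite (cluster (E \<omega>) 0) \<and> (\<exists>j. k \<le> j \<and> \<not> joined (E \<omega>) 0 (?h j \<omega>))}"
  have "(\<lambda>k. prob (?D k)) \<longlonglongrightarrow> prob (\<Inter>k. ?D k)"
  proof (rule finite_Lim_measure_decseq)
    show "decseq ?D" by (auto simp: decseq_def intro: order_trans)
  qed auto
  moreover have "prob (\<Inter>k. ?D k) = 0"
  proof -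
    have "AE \<omega> in M. \<omega> \<notin> (\<Inter>k. ?D k)"
      using AE_infinite_joined_hubs by eventually_elim (auto simp: eventually_sequentially)
    then have "emeasure M {\<omega> \<in> space M. \<omega> \<in> (\<Inter>k. ?D k)} = 0" by (rule emeasure_eq_0_AE)
    moreover have "{\<omega> \<in> space M. \<omega> \<in> (\<Inter>k. ?D k)} = (\<Inter>k. ?D k)" by blast
    ultimately have "emeasure M (\<Inter>k. ?D k) = 0" by (simp only:)
    then show ?thesis by (simp add: measure_def)
  qed
  ultimately have "eventually (\<lambda>k. prob (?D k) < \<epsilon> / 2) sequentially"
    using assms by (auto dest!: order_tendstoD(2)[where a = "\<epsilon> / 2"])
  then obtain k0 where k0: "\<And>k. k0 \<le> k \<Longrightarrow> prob (?D k) < \<epsilon> / 2" by (auto simp: eventually_sequentially)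
  show ?thesis
  proof (rule exI[of _ k0], intro allI impI)
    fix k assume k: "k0 \<le> k"
    let ?F = "\<lambda>n. {\<omega> \<in> space M. joined (E \<omega>) 0 (?h k \<omega>) \<and> \<not> near k n 0 (config \<omega>)}"
    have "(\<lambda>n. prob (?F n)) \<longlonglongrightarrow> prob (\<Inter>n. ?F n)"
    proof (rule finite_Lim_measure_decseq)
      show "decseq ?F" by (auto simp: decseq_def near_def intro: dist_le_mono)
    qed auto
    moreover have "(\<Inter>n. ?F n) = {}" by (auto simp: near_def joined_iff_dist_le)
    ultimately have "eventually (\<lambda>n. prob (?F n) < \<epsilon> / 2) sequentially"
      using assms by (auto dest!: order_tendstoD(2)[where a = "\<epsilon> / 2"])
    then obtain n where n: "prob (?F n) < \<epsilon> / 2" by (auto simp: eventually_sequentially)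
    have "prob {\<omega> \<in> space M. infinite (cluster (E \<omega>) 0) \<and> \<not> near k n 0 (config \<omega>)} \<le>
        sum_list (map prob [?D k, ?F n])"
      by (rule measure_le_sum_list) auto
    also have "\<dots> < \<epsilon>" using k0[OF k] n by simp
    finally show "\<exists>n. prob {\<omega> \<in> space M. infinite (cluster (E \<omega>) 0) \<and> \<not> near k n 0 (config \<omega>)} < \<epsilon>" ..
  qed
qed

lemma prob_near_translate:
  "prob {\<omega> \<in> space M. infinite (cluster (E \<omega>) v) \<and> \<not> near k n v (config \<omega>)} =
   prob {\<omega> \<in> space M. infinite (cluster (E \<omega>) 0) \<and> \<not> near k n 0 (config \<omega>)}"
proof -
  let ?P = "\<lambda>x. infinite (cluster (snd x) 0) \<and> \<not> near k n 0 x"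
  have "Measurable.pred config_space ?P" by measurable
  from prob_translate[OF this, of v]
  have "prob {\<omega> \<in> space M. ?P (translate v (config \<omega>))} = prob {\<omega> \<in> space M. ?P (config \<omega>)}" .
  moreover have "?P (translate v x) \<longleftrightarrow> infinite (cluster (snd x) v) \<and> \<not> near k n v x" for x
    using hub_translate[of v x 0 k] by (simp add: infinite_cluster_translate near_def dist_le_translate)
  ultimately show ?thesis by simp
qed

definition chain :: "nat \<Rightarrow> nat \<Rightarrow> int ^ 'd \<Rightarrow> ((int ^ 'd) \<Rightarrow> real) \<times> (int ^ 'd) set set \<Rightarrow> bool" where
  "chain k n v x \<longleftrightarrow> (\<forall>j\<in>{k..<n}. linked x v j)"

lemma pred_chain [measurable]: "Measurable.pred config_space (chain k n v)"
  unfolding chain_def[abs_def] by (intro pred_intros_finite pred_linked) auto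

lemma prob_not_chain:
  assumes J: "finite J" "card J \<le> 2"
  shows "prob {\<omega> \<in> space M. heavy J T (Wt \<omega>) \<and> \<not> chain k n v (config \<omega>)}
    \<le> (\<Sum>j\<in>{k..<n}. err j) * prob {\<omega> \<in> space M. heavy J T (Wt \<omega>)}"
proof -
  note [measurable] = pred_heavy[OF J(1)]
  have "{\<omega> \<in> space M. heavy J T (Wt \<omega>) \<and> \<not> chain k n v (config \<omega>)} =
      (\<Union>j\<in>{k..<n}. {\<omega> \<in> space M. heavy J T (Wt \<omega>) \<and> \<not> linked (config \<omega>) v j})"
    by (auto simp: chain_def)
  then have "prob {\<omega> \<in> space M. heavy J T (Wt \<omega>) \<and> \<not> chain k n v (config \<omega>)} \<le>
      (\<Sum>j\<in>{k..<n}. prob {\<omega> \<in> space M. heavy J T (Wt \<omega>) \<and> \<not> linked (config \<omega>) v j})"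
    by (auto intro!: finite_measure_subadditive_finite)
  also have "\<dots> \<le> (\<Sum>j\<in>{k..<n}. err j * prob {\<omega> \<in> space M. heavy J T (Wt \<omega>)})"
    by (intro sum_mono prob_not_linked J)
  finally show ?thesis by (simp add: sum_distrib_right)
qed

lemma err_tail:
  assumes "0 < \<epsilon>"
  obtains k0 where "\<And>k n. k0 \<le> k \<Longrightarrow> (\<Sum>j\<in>{k..<n}. err j) < \<epsilon>" "\<And>n. k0 \<le> n \<Longrightarrow> err n < \<epsilon>"
proof -
  obtain k0 where k0: "\<And>m n. k0 \<le> m \<Longrightarrow> norm (\<Sum>j=m..n. err j) < \<epsilon>"
    using summable_partial_sum_bound[OF summable_err assms] by blast
  show ?thesis
  proof (rule that[of k0])
    fix k n assume k: "k0 \<le> k"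
    have "(\<Sum>j\<in>{k..<n}. err j) \<le> (\<Sum>j\<in>{k..n}. err j)"
      using err_nonneg by (intro sum_mono2) auto
    also have "\<dots> < \<epsilon>" using k0[OF k, of n] by (simp add: abs_less_iff)
    finally show "(\<Sum>j\<in>{k..<n}. err j) < \<epsilon>" .
  next
    fix n assume "k0 \<le> n"
    then show "err n < \<epsilon>" using k0[of n n] by (simp add: abs_less_iff)
  qed
qed

lemma dist_le_through_hubs:
  assumes "k \<le> n" "chain k n u x" "chain k n v x" "crossed x u v n"
    and "dist_le (snd x) i u (hub (fst x) u k)" "dist_le (snd x) i v (hub (fst x) v k)"
  shows "dist_le (snd x) (2 * i + 2 * n + 1) u v"
proof -
  let ?G = "snd x"
  have c: "dist_le ?G (n - k) (hub (fst x) w k) (hub (fst x) w n)" if "chain k n w x" for w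
    using that assms(1) by (intro chain_dist_le) (auto simp: chain_def linked_def)
  have "dist_le ?G (i + (n - k)) u (hub (fst x) u n)"
    by (rule dist_le_trans[OF assms(5) c[OF assms(2)]])
  moreover have "dist_le ?G 1 (hub (fst x) u n) (hub (fst x) v n)"
    using assms(4) by (intro adj_or_eq_dist_le) (simp add: crossed_def)
  moreover have "dist_le ?G (i + (n - k)) (hub (fst x) v n) v"
    by (rule dist_le_sym[OF dist_le_trans[OF assms(6) c[OF assms(3)]]])
  ultimately have "dist_le ?G ((i + (n - k) + 1) + (i + (n - k))) u v"
    by (blast intro: dist_le_trans)
  then show ?thesis by (rule dist_le_mono) simp
qed

text \<open>If \<open>x\<close> is joined to 0 and the cluster of 0 is infinite, then so is the cluster of \<open>x\<close>. Up to probability \<open>\<epsilon>\<close> both are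
  then close to their hubs of scale \<open>k\<close>, both chains from \<open>k\<close> to \<open>n\<close> are present, and they are connected at
  scale \<open>n\<close>. The constants \<open>k\<close> and \<open>i\<close> are uniform in \<open>x\<close> and \<open>n\<close>.\<close>

lemma prob_joined_not_close:
  assumes "0 < \<epsilon>"
  shows "\<exists>k i. \<forall>x n. k \<le> n \<longrightarrow> lattice_norm x \<le> radius n \<longrightarrow>
    prob {\<omega> \<in> space M. joined (E \<omega>) 0 x \<and> \<not> dist_le (E \<omega>) (2 * i + 2 * n + 1) 0 x} \<le>
    \<epsilon> + prob {\<omega> \<in> space M. joined (E \<omega>) 0 x \<and> finite (cluster (E \<omega>) 0)}"
proof -
  have e: "0 < \<epsilon> / 5" using assms by simp
  obtain k1 where k1: "\<And>k. k1 \<le> k \<Longrightarrow>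
      \<exists>n. prob {\<omega> \<in> space M. infinite (cluster (E \<omega>) 0) \<and> \<not> near k n 0 (config \<omega>)} < \<epsilon> / 5"
    using hub_near_if_infinite[OF e] by blast
  obtain k2 where k2: "\<And>k n. k2 \<le> k \<Longrightarrow> (\<Sum>j\<in>{k..<n}. err j) < \<epsilon> / 5" "\<And>n. k2 \<le> n \<Longrightarrow> err n < \<epsilon> / 5"
    using err_tail[OF e] by blast
  define k where "k = max k1 k2"
  obtain i where i: "prob {\<omega> \<in> space M. infinite (cluster (E \<omega>) 0) \<and> \<not> near k i 0 (config \<omega>)} < \<epsilon> / 5"
    using k1[of k] by (auto simp: k_def)
  have "prob {\<omega> \<in> space M. joined (E \<omega>) 0 x \<and> \<not> dist_le (E \<omega>) (2 * i + 2 * n + 1) 0 x} \<le>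
      \<epsilon> + prob {\<omega> \<in> space M. joined (E \<omega>) 0 x \<and> finite (cluster (E \<omega>) 0)}"
    if n: "k \<le> n" and x: "lattice_norm x \<le> radius n" for x n
  proof -
    let ?N = "\<lambda>v. {\<omega> \<in> space M. infinite (cluster (E \<omega>) v) \<and> \<not> near k i v (config \<omega>)}"
    let ?C = "\<lambda>v. {\<omega> \<in> space M. \<not> chain k n v (config \<omega>)}"
    let ?X = "{\<omega> \<in> space M. \<not> crossed (config \<omega>) 0 x n}"
    let ?F = "{\<omega> \<in> space M. joined (E \<omega>) 0 x \<and> finite (cluster (E \<omega>) 0)}"
    have Fm: "?F \<in> events"
    proof -
      have "Measurable.pred M (\<lambda>\<omega>. joined (E \<omega>) 0 x \<and> \<not> infinite (cluster (E \<omega>) 0))" by measurable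
      then show ?thesis by (simp add: pred_def)
    qed
    have Nm: "?N v \<in> events" for v
    proof -
      note [measurable] = pred_config_compose[OF pred_near[of k i v]]
      show ?thesis by measurable
    qed
    have Cm: "?C v \<in> events" for v
    proof -
      note [measurable] = pred_config_compose[OF pred_chain[of k n v]]
      show ?thesis by measurable
    qed
    have Xm: "?X \<in> events"
    proof -
      note [measurable] = pred_config_compose[OF pred_crossed[of 0 x n]]
      show ?thesis by measurable
    qed
    have "prob {\<omega> \<in> space M. joined (E \<omega>) 0 x \<and> \<not> dist_le (E \<omega>) (2 * i + 2 * n + 1) 0 x} \<le>
        sum_list (map prob [?F, ?N 0, ?N x, ?C 0, ?C x, ?X])"
    proof (rule measure_le_sum_list)
      show "{\<omega> \<in> space M. joined (E \<omega>) 0 x \<and> \<not> dist_le (E \<omega>) (2 * i + 2 * n + 1) 0 x} \<subseteq>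
          \<Union> (set [?F, ?N 0, ?N x, ?C 0, ?C x, ?X])"
      proof
        fix \<omega> assume "\<omega> \<in> {\<omega> \<in> space M. joined (E \<omega>) 0 x \<and> \<not> dist_le (E \<omega>) (2 * i + 2 * n + 1) 0 x}"
        then have \<omega>: "\<omega> \<in> space M" "joined (E \<omega>) 0 x" "\<not> dist_le (E \<omega>) (2 * i + 2 * n + 1) 0 x" by auto
        have "cluster (E \<omega>) x = cluster (E \<omega>) 0"
          using \<omega>(2) cluster_joined_in[of x "E \<omega>" 0] by (auto simp: cluster_def)
        moreover have "\<not> (near k i 0 (config \<omega>) \<and> near k i x (config \<omega>) \<and> chain k n 0 (config \<omega>) \<and>
            chain k n x (config \<omega>) \<and> crossed (config \<omega>) 0 x n)"
          using dist_le_through_hubs[OF n, of 0 "config \<omega>" x i] \<omega>(3) by (auto simp: near_def)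
        ultimately show "\<omega> \<in> \<Union> (set [?F, ?N 0, ?N x, ?C 0, ?C x, ?X])" using \<omega> by auto
      qed
    qed (use Fm Nm Cm Xm in auto)
    also have "\<dots> = prob ?F + prob (?N 0) + prob (?N x) + prob (?C 0) + prob (?C x) + prob ?X" by simp
    also have "prob (?N x) = prob (?N 0)" by (rule prob_near_translate)
    also have "prob ?F + prob (?N 0) + prob (?N 0) + prob (?C 0) + prob (?C x) + prob ?X \<le> \<epsilon> + prob ?F"
    proof -
      have C: "prob (?C v) < \<epsilon> / 5" for v
        using prob_not_chain[of "{}" 0 k n v] k2(1)[of k n] by (simp add: prob_space k_def)
      have X: "prob ?X < \<epsilon> / 5"
        using prob_not_crossed[of "{}" 0 x n 0] k2(2)[of n] n x
        by (simp add: prob_space k_def lattice_norm_minus)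
      show ?thesis using i X C[of 0] C[of x] by linarith
    qed
    finally show ?thesis .
  qed
  then show ?thesis by blast
qed

text \<open>Force 0 and \<open>x\<close> to have weights above a large constant \<open>T\<close>. This has a probability independent of \<open>x\<close>, and given it the
  connection through the hubs fails with probability less than one half.\<close>

lemma prob_joined_bounded_below: "\<exists>\<delta>>0. \<forall>x. x \<noteq> 0 \<longrightarrow> \<delta> \<le> prob {\<omega> \<in> space M. joined (E \<omega>) 0 x}"
proof -
  obtain k where k: "\<And>k' n. k \<le> k' \<Longrightarrow> (\<Sum>j\<in>{k'..<n}. err j) < 1 / 16" "\<And>n. k \<le> n \<Longrightarrow> err n < 1 / 16"
    using err_tail[of "1 / 16"] by auto
  define B where "B = (real CARD('d) * radius k) powr \<alpha>"
  have B: "0 < B" using radius_pos[of k] by (simp add: B_def)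
  have lev: "0 < level k" using level_ge_1[of k] by simp
  define T where "T = max 1 (ln 16 * B / (lam * level k))"
  have T: "1 \<le> T" by (simp add: T_def)
  have T_rate: "exp (- (lam * T * level k / B)) \<le> 1 / 16"
  proof -
    have "ln 16 * B / (lam * level k) \<le> T" by (simp add: T_def)
    then have "ln 16 \<le> lam * T * level k / B" using lam_pos lev B by (simp add: field_simps)
    then have "exp (- (lam * T * level k / B)) \<le> exp (- ln 16)" by simp
    also have "\<dots> = 1 / 16" by (simp add: exp_minus inverse_eq_divide)
    finally show ?thesis .
  qed
  define m where "m = measure \<mu> {T<..}"
  have "0 < c * T powr (- p)" using c_pos T by simp
  then have m: "0 < m" using tail[OF T] by (simp add: m_def)
  have "m ^ 2 / 2 \<le> prob {\<omega> \<in> space M. joined (E \<omega>) 0 x}" if x: "x \<noteq> 0" for x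
  proof -
    let ?J = "{0, x}"
    have J: "finite ?J" "card ?J \<le> 2" by (auto simp: card_insert_if)
    let ?H = "\<lambda>\<omega>. heavy ?J T (Wt \<omega>)"
    let ?q = "prob {\<omega> \<in> space M. ?H \<omega>}"
    note [measurable] = pred_heavy[OF J(1)]
    have q: "?q = m ^ 2"
      using prob_weights_product[of ?J "\<lambda>_. {T<..}"] x by (simp add: heavy_def m_def power2_eq_square)
    obtain n where n: "k \<le> n" "lattice_norm (0 - x) \<le> radius n"
      using eventually_conj[OF eventually_ge_at_top[of k] eventually_radius_ge[of "lattice_norm (0 - x)"]]
      by (auto simp: eventually_sequentially)
    let ?A = "\<lambda>v. {\<omega> \<in> space M. ?H \<omega> \<and> \<not> adj_or_eq (E \<omega>) v (hub (Wt \<omega>) v k)}"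
    let ?C = "\<lambda>v. {\<omega> \<in> space M. ?H \<omega> \<and> \<not> chain k n v (config \<omega>)}"
    let ?X = "{\<omega> \<in> space M. ?H \<omega> \<and> \<not> crossed (config \<omega>) 0 x n}"
    let ?Y = "{\<omega> \<in> space M. ?H \<omega> \<and> \<not> joined (E \<omega>) 0 x}"
    \<comment> \<open>The individual bounds add up to 2/8 + 2/16 + 1/16, which is less than 1/2.\<close>
    have "prob ?Y \<le> sum_list (map prob [?A 0, ?A x, ?C 0, ?C x, ?X])"
    proof (rule measure_le_sum_list)
      show "?Y \<subseteq> \<Union> (set [?A 0, ?A x, ?C 0, ?C x, ?X])"
      proof
        fix \<omega> assume \<omega>: "\<omega> \<in> ?Y"
        have "\<not> (adj_or_eq (E \<omega>) 0 (hub (Wt \<omega>) 0 k) \<and> adj_or_eq (E \<omega>) x (hub (Wt \<omega>) x k) \<and>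
            chain k n 0 (config \<omega>) \<and> chain k n x (config \<omega>) \<and> crossed (config \<omega>) 0 x n)"
          using dist_le_through_hubs[OF n(1), of 0 "config \<omega>" x 1] \<omega>
          by (auto dest!: adj_or_eq_dist_le simp: joined_iff_dist_le)
        then show "\<omega> \<in> \<Union> (set [?A 0, ?A x, ?C 0, ?C x, ?X])" using \<omega> by auto
      qed
      have "?A v \<in> events" for v by measurable
      moreover have "?C v \<in> events" for v by measurable
      moreover have "?X \<in> events" by measurable
      ultimately show "set [?A 0, ?A x, ?C 0, ?C x, ?X] \<subseteq> events" by auto
    qed
    also have "\<dots> = prob (?A 0) + prob (?A x) + prob (?C 0) + prob (?C x) + prob ?X" by simp
    also have "\<dots> \<le> ?q / 2"
    proof -
      have A: "prob (?A v) \<le> 1 / 8 * ?q" if "v \<in> ?J" for v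
      proof -
        have "prob (?A v) \<le> (err k + exp (- (lam * T * level k / B))) * ?q"
          unfolding B_def using T by (intro prob_heavy_not_joined_hub[OF J that]) auto
        also have "\<dots> \<le> 1 / 8 * ?q"
          using k(2)[of k] T_rate by (intro mult_right_mono) auto
        finally show ?thesis .
      qed
      have C: "prob (?C v) \<le> 1 / 16 * ?q" for v
      proof -
        have "prob (?C v) \<le> (\<Sum>j\<in>{k..<n}. err j) * ?q" by (rule prob_not_chain[OF J])
        also have "\<dots> \<le> 1 / 16 * ?q" using k(1)[of k n] by (intro mult_right_mono) auto
        finally show ?thesis .
      qed
      have X: "prob ?X \<le> 1 / 16 * ?q"
      proof -
        have "prob ?X \<le> err n * ?q" by (rule prob_not_crossed[OF J n(2)])
        also have "\<dots> \<le> 1 / 16 * ?q" using k(2)[OF n(1)] by (intro mult_right_mono) auto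
        finally show ?thesis .
      qed
      have "0 \<le> ?q" by simp
      moreover have "prob (?A 0) \<le> 1 / 8 * ?q" "prob (?A x) \<le> 1 / 8 * ?q" by (rule A; simp)+
      ultimately show ?thesis using C[of 0] C[of x] X by linarith
    qed
    finally have Y: "prob ?Y \<le> ?q / 2" .
    have "?q \<le> sum_list (map prob [?Y, {\<omega> \<in> space M. joined (E \<omega>) 0 x}])"
      by (rule measure_le_sum_list) auto
    then show ?thesis using Y q by simp
  qed
  then show ?thesis using m by (intro exI[of _ "m ^ 2 / 2"]) auto
qed

section \<open>The distance between connected vertices\<close>

text \<open>The level \<open>n\<close> with \<open>radius n \<ge> |x|\<close> is about \<open>ln (ln |x|) / ln \<beta>\<close>, and the path through the hubs has \<open>2 * n\<close> edges
  up to a bounded number. The gap between \<open>1 / ln \<beta>\<close> and \<open>b\<close> absorbs that number.\<close>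

lemma cond_prob_close_tendsto:
  assumes \<eta>: "1 / ln \<beta> < b"
  shows "((\<lambda>x. \<P>(\<omega> in M. ereal_of_enat (graph_dist (E \<omega>) 0 x) \<le> ereal (2 * b * ln (ln (lattice_norm x)))
      \<bar> joined (E \<omega>) 0 x)) \<longlongrightarrow> 1) (filtercomap lattice_norm at_top)"
proof (rule tendstoI)
  fix \<epsilon> :: real assume \<epsilon>: "0 < \<epsilon>"
  let ?F = "filtercomap (lattice_norm :: int ^ 'd \<Rightarrow> real) at_top"
  obtain \<delta> where \<delta>: "0 < \<delta>" "\<And>x. x \<noteq> 0 \<Longrightarrow> \<delta> \<le> prob {\<omega> \<in> space M. joined (E \<omega>) 0 x}"
    using prob_joined_bounded_below by blast
  define e where "e = \<epsilon> * \<delta> / 3"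
  have e: "0 < e" using \<epsilon> \<delta> by (simp add: e_def)
  obtain k i where ki: "\<And>x n. k \<le> n \<Longrightarrow> lattice_norm x \<le> radius n \<Longrightarrow>
    prob {\<omega> \<in> space M. joined (E \<omega>) 0 x \<and> \<not> dist_le (E \<omega>) (2 * i + 2 * n + 1) 0 x} \<le>
    e + prob {\<omega> \<in> space M. joined (E \<omega>) 0 x \<and> finite (cluster (E \<omega>) 0)}"
    using prob_joined_not_close[OF e] by blast
  let ?far = "\<lambda>n. {\<omega> \<in> space M. finite (cluster (E \<omega>) 0) \<and> (\<exists>y. joined (E \<omega>) 0 y \<and> real n \<le> lattice_norm y)}"
  have "eventually (\<lambda>n. prob (?far n) < e) sequentially"
    using tendsto_prob_finite_cluster_far e by (auto dest!: order_tendstoD(2)[where a = e])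
  then obtain n0 where n0: "prob (?far n0) < e" by (auto simp: eventually_sequentially)
  have lb: "0 < ln \<beta>" using beta by simp
  define L where "L = ln (ln 2 :: real)"
  \<comment> \<open>The first bound gives \<open>n \<ge> k\<close>, the second makes the path short enough.\<close>
  define Z where "Z = max (real k * ln \<beta> + L) ((2 * real i + 3 + 2 * \<bar>L\<bar> / ln \<beta>) / (2 * (b - 1 / ln \<beta>)))"
  have LL: "filterlim (\<lambda>r. ln (ln r) :: real) at_top at_top"
    by (rule filterlim_compose[OF ln_at_top ln_at_top])
  have "eventually (\<lambda>r. max 0 Z \<le> ln (ln r) \<and> max (exp 1) (real n0) \<le> r) at_top"
    using LL by (intro eventually_conj eventually_ge_at_top) (simp only: filterlim_at_top)
  then have "eventually (\<lambda>x. max 0 Z \<le> ln (ln (lattice_norm x)) \<and> max (exp 1) (real n0) \<le> lattice_norm x) ?F"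
    by (rule eventually_filtercomapI)
  then show "eventually (\<lambda>x. dist (\<P>(\<omega> in M. ereal_of_enat (graph_dist (E \<omega>) 0 x) \<le>
      ereal (2 * b * ln (ln (lattice_norm x))) \<bar> joined (E \<omega>) 0 x)) 1 < \<epsilon>) ?F"
  proof eventually_elim
    case (elim x)
    let ?r = "lattice_norm x" and ?l = "ln (ln (lattice_norm x))"
    have r: "exp 1 \<le> ?r" "real n0 \<le> ?r" "0 \<le> ?l" "Z \<le> ?l" using elim by auto
    have r1: "1 < ?r" using r(1) exp_gt_one[of "1::real"] by linarith
    then have x0: "x \<noteq> 0" using lattice_norm_eq_0_iff[of x] by auto
    have lr: "1 \<le> ln ?r" using r(1) r1 by (simp add: ln_ge_iff)
    define n where "n = nat \<lceil>(?l - L) / ln \<beta>\<rceil>"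
    have n_ge: "(?l - L) / ln \<beta> \<le> real n" unfolding n_def by linarith
    have "real k * ln \<beta> + L \<le> ?l" using r(4) by (simp add: Z_def)
    then have "real k \<le> (?l - L) / ln \<beta>" using lb by (simp add: field_simps)
    then have kn: "k \<le> n" using n_ge by linarith
    have "0 \<le> (?l - L) / ln \<beta>" using \<open>real k \<le> (?l - L) / ln \<beta>\<close> by linarith
    then have n_le: "real n \<le> (?l - L) / ln \<beta> + 1" unfolding n_def by linarith
    have rad: "?r \<le> radius n"
    proof -
      have "?l - L \<le> real n * ln \<beta>" using n_ge lb by (simp add: field_simps)
      then have "exp (?l - L) \<le> exp (real n * ln \<beta>)" by simp
      also have "\<dots> = \<beta> ^ n" using beta by (simp add: exp_of_nat_mult)
      finally have "ln ?r / ln 2 \<le> \<beta> ^ n" using lr by (simp add: exp_diff L_def)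
      then have "ln ?r \<le> \<beta> ^ n * ln 2" by (simp add: field_simps)
      then have "exp (ln ?r) \<le> exp (\<beta> ^ n * ln 2)" by simp
      then show ?thesis using r1 by (simp add: radius_def powr_def)
    qed
    let ?y = "2 * b * ?l"
    have steps: "real (2 * i + 2 * n + 1) \<le> ?y"
    proof -
      have pos: "0 < 2 * (b - 1 / ln \<beta>)" using \<eta> by simp
      have "(2 * real i + 3 + 2 * \<bar>L\<bar> / ln \<beta>) / (2 * (b - 1 / ln \<beta>)) \<le> ?l" using r(4) by (simp add: Z_def)
      then have "2 * real i + 3 + 2 * \<bar>L\<bar> / ln \<beta> \<le> ?l * (2 * (b - 1 / ln \<beta>))"
        using pos by (simp only: pos_divide_le_eq)
      moreover have "?l * (2 * (b - 1 / ln \<beta>)) = ?y - 2 * (?l / ln \<beta>)" by (simp add: algebra_simps)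
      moreover have "- L / ln \<beta> \<le> \<bar>L\<bar> / ln \<beta>" using lb by (intro divide_right_mono) auto
      moreover have "(?l - L) / ln \<beta> = ?l / ln \<beta> + - L / ln \<beta>" by (simp add: diff_divide_distrib)
      moreover have "2 * \<bar>L\<bar> / ln \<beta> = 2 * (\<bar>L\<bar> / ln \<beta>)" by simp
      moreover have "real (2 * i + 2 * n + 1) = 2 * real i + 2 * real n + 1" by simp
      ultimately show ?thesis using n_le by linarith
    qed
    have y0: "0 \<le> ?y" using steps by linarith
    define N where "N = nat \<lfloor>?y\<rfloor>"
    have N: "2 * i + 2 * n + 1 \<le> N" using steps unfolding N_def by linarith
    have ev: "ereal_of_enat (graph_dist (E \<omega>) 0 x) \<le> ereal ?y \<longleftrightarrow> dist_le (E \<omega>) N 0 x" for \<omega>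
      by (simp add: ereal_of_enat_le_iff[OF y0] graph_dist_le_iff N_def)
    let ?J = "{\<omega> \<in> space M. joined (E \<omega>) 0 x}"
    let ?G = "{\<omega> \<in> space M. dist_le (E \<omega>) N 0 x \<and> joined (E \<omega>) 0 x}"
    let ?B = "{\<omega> \<in> space M. joined (E \<omega>) 0 x \<and> \<not> dist_le (E \<omega>) N 0 x}"
    have "prob (?G \<union> ?B) = prob ?G + prob ?B" by (rule finite_measure_Union) auto
    moreover have "?G \<union> ?B = ?J" by auto
    ultimately have split: "prob ?J = prob ?G + prob ?B" by simp
    have "prob ?B \<le> prob {\<omega> \<in> space M. joined (E \<omega>) 0 x \<and> \<not> dist_le (E \<omega>) (2 * i + 2 * n + 1) 0 x}"
      by (intro finite_measure_mono) (auto intro: dist_le_mono[OF _ N])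
    also have "\<dots> \<le> e + prob {\<omega> \<in> space M. joined (E \<omega>) 0 x \<and> finite (cluster (E \<omega>) 0)}"
      by (rule ki[OF kn rad])
    also have "prob {\<omega> \<in> space M. joined (E \<omega>) 0 x \<and> finite (cluster (E \<omega>) 0)} \<le> prob (?far n0)"
    proof (rule finite_measure_mono)
      have "Measurable.pred M (\<lambda>\<omega>. \<not> infinite (cluster (E \<omega>) 0))" by measurable
      then have [measurable]: "Measurable.pred M (\<lambda>\<omega>. finite (cluster (E \<omega>) 0))" by simp
      show "?far n0 \<in> events" by measurable
    qed (use r(2) in auto)
    finally have B: "prob ?B < 2 * e" using n0 by simp
    have J: "\<delta> \<le> prob ?J" by (rule \<delta>(2)[OF x0])
    have "\<P>(\<omega> in M. ereal_of_enat (graph_dist (E \<omega>) 0 x) \<le> ereal ?y \<bar> joined (E \<omega>) 0 x) = prob ?G / prob ?J"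
      by (simp only: cond_prob_def ev)
    also have "\<dots> = 1 - prob ?B / prob ?J" using split J \<delta>(1) by (simp add: field_simps)
    finally have "dist (\<P>(\<omega> in M. ereal_of_enat (graph_dist (E \<omega>) 0 x) \<le> ereal ?y \<bar> joined (E \<omega>) 0 x)) 1
        = prob ?B / prob ?J"
      by (simp add: dist_real_def)
    also have "\<dots> \<le> prob ?B / \<delta>" using J \<delta>(1) by (intro divide_left_mono) auto
    also have "\<dots> < \<epsilon>"
    proof -
      have "2 * e < \<epsilon> * \<delta>" using mult_pos_pos[OF \<epsilon> \<delta>(1)] unfolding e_def by linarith
      then have "prob ?B < \<epsilon> * \<delta>" using B by linarith
      then show ?thesis using \<delta>(1) by (simp add: pos_divide_less_eq)
    qed
    finally show ?case .
  qed
qed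

end

theorem theorem5p1:
  fixes M :: "'a measure"
    and W :: "int ^ 'd \<Rightarrow> 'a \<Rightarrow> real"
    and E :: "'a \<Rightarrow> (int ^ 'd) set set"
    and \<mu> :: "real measure"
    and lam \<alpha> \<tau> c \<gamma> \<eta> :: real
  assumes "scale_free_percolation M W E \<mu> lam \<alpha>"
    and "\<alpha> > real CARD('d)"
    and "lam > 0"
    and "integrable \<mu> (\<lambda>w. w) \<Longrightarrow> (\<integral>w. w \<partial>\<mu>) = 1"
    and "\<tau> > 1"
    and "c > 0"
    and "\<And>w. w \<ge> 1 \<Longrightarrow> measure \<mu> {w<..} \<ge> c * w powr (- (\<tau> - 1))"
    and "\<gamma> = \<alpha> * (\<tau> - 1) / real CARD('d)"
    and "1 < \<gamma>" and "\<gamma> < 2"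
    and "\<eta> > 0"
  shows "((\<lambda>x. \<P>(\<omega> in M.
            ereal_of_enat (graph_dist (E \<omega>) 0 x)
              \<le> ereal ((1 + \<eta>) * (2 * ln (ln (lattice_norm x)) / \<bar>ln (\<gamma> - 1)\<bar>))
            \<bar> joined (E \<omega>) 0 x)) \<longlongrightarrow> 1)
         (filtercomap lattice_norm at_top)"
proof -
  define l where "l = \<bar>ln (\<gamma> - 1)\<bar>"
  have l: "l = - ln (\<gamma> - 1)" "0 < l"
    using assms(9,10) ln_less_zero[of "\<gamma> - 1"] by (auto simp: l_def)
  \<comment> \<open>Any \<open>\<beta>\<close> with \<open>l / (1 + \<eta>) < ln \<beta> < l\<close> would do.\<close>
  define \<beta> where "\<beta> = exp (l / (1 + \<eta> / 2))"
  have ln_beta: "ln \<beta> = l / (1 + \<eta> / 2)" by (simp add: \<beta>_def)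
  have beta: "1 < \<beta>" using l(2) assms(11) by (simp add: \<beta>_def)
  have "l / (1 + \<eta> / 2) < l" using l(2) assms(11) by (simp add: field_simps)
  then have "\<beta> < exp l" by (simp add: \<beta>_def)
  also have "exp l = 1 / (\<gamma> - 1)" using assms(9) by (simp add: l(1) exp_minus inverse_eq_divide)
  \<comment> \<open>This is what leaves room for \<open>a\<close> between the two bounds below.\<close>
  finally have gb: "\<gamma> * \<beta> < 1 + \<beta>" using assms(9) by (simp add: field_simps)
  have alpha: "0 < \<alpha>" using assms(2) by linarith
  have d: "0 < real CARD('d)" by simp
  have "\<alpha> * \<beta> / (1 + \<beta>) < real CARD('d) / (\<tau> - 1)"
  proof -
    have "\<alpha> * (\<tau> - 1) = \<gamma> * real CARD('d)" using d by (simp add: assms(8))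
    then have "(\<alpha> * (\<tau> - 1)) * \<beta> = (\<gamma> * real CARD('d)) * \<beta>" by (rule arg_cong)
    then have "\<alpha> * \<beta> * (\<tau> - 1) = \<gamma> * \<beta> * real CARD('d)" by (simp only: mult_ac)
    also have "\<dots> < (1 + \<beta>) * real CARD('d)" using gb d by (rule mult_strict_right_mono)
    finally show ?thesis using assms(5) beta by (simp add: field_simps)
  qed
  then obtain a where a: "\<alpha> * \<beta> / (1 + \<beta>) < a" "a < real CARD('d) / (\<tau> - 1)" using dense by blast
  have "0 < \<alpha> * \<beta> / (1 + \<beta>)" using alpha beta by simp
  interpret scale_free_percolation M W E \<mu> lam \<alpha> by (rule assms(1))
  interpret hub_percolation M W E \<mu> lam \<alpha> "\<tau> - 1" c a \<beta>
  proof
    show "0 < a" using a(1) \<open>0 < \<alpha> * \<beta> / (1 + \<beta>)\<close> by linarith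
    show "a * (\<tau> - 1) < real CARD('d)" using a(2) assms(5) by (simp add: field_simps)
    show "\<alpha> * \<beta> < a * (1 + \<beta>)" using a(1) beta by (simp add: field_simps)
  qed (use assms beta alpha in auto)
  have "1 / ln \<beta> < (1 + \<eta>) / l" using l(2) assms(11) by (simp add: ln_beta divide_strict_right_mono)
  from cond_prob_close_tendsto[OF this]
  have "((\<lambda>x. \<P>(\<omega> in M. ereal_of_enat (graph_dist (E \<omega>) 0 x) \<le>
      ereal (2 * ((1 + \<eta>) / l) * ln (ln (lattice_norm x))) \<bar> joined (E \<omega>) 0 x)) \<longlongrightarrow> 1)
      (filtercomap lattice_norm at_top)" .
  moreover have "2 * ((1 + \<eta>) / l) * y = (1 + \<eta>) * (2 * y / \<bar>ln (\<gamma> - 1)\<bar>)" for y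
    by (simp add: l_def)
  ultimately show ?thesis by simp
qed

end
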